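(* Suppose that for each stage $t\in\mathcal T$ the value function $Q_t(x_{t-1};\xi_t)$ is $l_t$-Lipschitz continuous in $\xi_t$ for any $x_{t-1}\in\mathcal X_{t-1}$, and that the empirical measures are strictly feasible, i.e. $\rho_{t,0}>0$ and $\langle g_{t,j},\hat\nu_t\rangle<\rho_{t,j}$ for all $j=1,\dots,m_t$ and $t\ge2$. Then the difference of optimal values between the DR-MCO and the nominal MSCO satisfies $$Q_1(x_0;\xi_1)-Q_1^{\mathrm{Nomin}}(x_0;\xi_1)\le\sum_{t=2}^{T}l_t\rho_{t,0}.$$ Consequently, suppose moreover that $Q_t^{\mathrm{Nomin}}(x_{t-1};\xi_t)$ is also $l_t$-Lipschitz continuous in $\xi_t$, that $\hat\nu_t$ is the empirical measure of $n_t$ i.i.d. samples of a true distribution $\nu_t\in\mathcal W_t$ (samples of different stages being independent), and that, for a given $\alpha\in(0,1)$ and each $t\in\{2,\dots,T\}$, $\rho_{t,0}$ satisfies at least one of the following: 1. $\nu_t$ is sub-Gaussian, $\delta_t\ge3$, and $n_t\min\{\rho_{t,0}^{\delta_t},\rho_{t,0}^2\}\ge\frac1{C'_t}\bigl[\ln C_t-\ln(1-\alpha^{1/(T-1)})\bigr]$; 2. $\nu_t$ has finite third moments, $\delta_t\ge2$, and $n_t\min\{\rho_{t,0}^{\delta_t},\rho_{t,0}^2\}\ge\max\Bigl\{\frac1{C'_t}\bigl[\ln(2C_t)-\ln(1-\alpha^{1/(T-1)})\bigr],\frac{2C''_t}{1-\alpha^{1/(T-1)}}\Bigr\}$. Then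 with probability at least $\alpha$, $$Q_1(x_0;\xi_1)-v^{\mathrm{Eval}}\le2\sum_{t=2}^{T}l_t\rho_{t,0}.$$
   Context: **DR-MCO setting.** Let $T\ge2$ and $\mathcal T=\{1,\dots,T\}$. For each $t\in\mathcal T$, the state space $\mathcal X_t$ is a convex subset of a finite-dimensional Euclidean space and $\Xi_t\subseteq\mathbb R^{\delta_t}$ is the uncertainty set; $\mathcal X_0=\{x_0\}$ and $\Xi_1=\{\xi_1\}$ are given singletons. The local cost $f_t(x_{t-1},x_t;\xi_t)\in[0,+\infty]$ is lower semicontinuous, and convex in $(x_{t-1},x_t)$ for each $\xi_t\in\Xi_t$. For $t\ge2$ let $\hat\xi_{t,1},\dots,\hat\xi_{t,n_t}\in\Xi_t$ be samples and $\hat\nu_t=\frac1{n_t}\sum_{k=1}^{n_t}\Delta_{\hat\xi_{t,k}}$ the empirical measure ($\Delta_\xi$ is the Dirac measure at $\xi$). Let $d_t(\cdot,\cdot)$ be a distance on $\Xi_t$ (Lipschitz continuity in $\xi_t$ is with respect to $d_t$), and let $W_t(\mu,\nu)=\inf_\pi\int d_t\,d\pi$ (infimum over couplings $\pi$ of $\mu,\nu$) be the Wasserstein distance of order 1 on probability measures on $\Xi_t$. Let $\mathcal W_t$ be the set of probability measures $\mu$ on $\Xi_t$ with $\int d_t(\bar\xi,\xi)\,d\mu(\xi)<\infty$ for some $\bar\xi\in\Xi_t$. Let $g_{t,1},\dots,g_{t,m_t}$ be continuous real functions on $\Xi_t$ with $|g_{t,j}(\xi)|\le C(1+d_t(\bar\xi,\xi))$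 for some $C>0$, $\bar\xi\in\Xi_t$, and write $\langle g,p\rangle=\int g\,dp$. With $\rho_t=(\rho_{t,0},\dots,\rho_{t,m_t})\in\mathbb R^{m_t+1}$, the ambiguity set is $$\mathcal P_t=\{p\in\mathcal W_t:\ W_t(p,\hat\nu_t)\le\rho_{t,0},\ \langle g_{t,j},p\rangle\le\rho_{t,j},\ j=1,\dots,m_t\}.$$ Cost-to-go and value functions are defined recursively by $\mathcal Q_T\equiv0$, $$Q_t(x_{t-1};\xi_t)=\inf_{x_t\in\mathcal X_t}f_t(x_{t-1},x_t;\xi_t)+\mathcal Q_t(x_t),\qquad \mathcal Q_{t-1}(x_{t-1})=\sup_{p_t\in\mathcal P_t}\int_{\Xi_t}Q_t(x_{t-1};\xi_t)\,dp_t(\xi_t).$$ The optimal value of the DR-MCO is $Q_1(x_0;\xi_1)$. **Nominal MSCO.** $\mathcal Q_T^{\mathrm{Nomin}}\equiv0$, $Q_t^{\mathrm{Nomin}}(x_{t-1};\xi_t)=\inf_{x_t\in\mathcal X_t}f_t(x_{t-1},x_t;\xi_t)+\mathcal Q_t^{\mathrm{Nomin}}(x_t)$, and $\mathcal Q_{t-1}^{\mathrm{Nomin}}(x_{t-1})=\frac1{n_t}\sum_{k=1}^{n_t}Q_t^{\mathrm{Nomin}}(x_{t-1};\hat\xi_{t,k})$. **Out-of-sample evaluation.** Fix an optimal policy of the DR-MCO: $x_1^*\in\arg\min_{x_1\in\mathcal X_1}\{f_1(x_0,x_1;\xi_1)+\mathcal Q_1(x_1)\}$ and maps $x_t^*:\mathcal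 X_{t-1}\times\Xi_t\to\mathcal X_t$, $t=2,\dots,T$, with $x_t^*(x_{t-1},\cdot)$ Borel measurable and $x_t^*(x_{t-1},\xi_t)\in\arg\min_{x_t\in\mathcal X_t}\{f_t(x_{t-1},x_t;\xi_t)+\mathcal Q_t(x_t)\}$ for all $x_{t-1},\xi_t$. Define $\mathcal Q_T^{\mathrm{Eval}}\equiv0$, $$\mathcal Q_{t-1}^{\mathrm{Eval}}(x_{t-1})=\int_{\Xi_t}\bigl[f_t(x_{t-1},x_t^*(x_{t-1},\xi_t);\xi_t)+\mathcal Q_t^{\mathrm{Eval}}(x_t^*(x_{t-1},\xi_t))\bigr]d\nu_t(\xi_t),$$ and $v^{\mathrm{Eval}}=f_1(x_0,x_1^*;\xi_1)+\mathcal Q_1^{\mathrm{Eval}}(x_1^* )$. **Tail conditions.** $\mu\in\mathcal W_t$ is sub-Gaussian if $\sup_{\|u\|=1}\int\exp(C(u^{\mathsf T}\xi)^2)\,d\mu(\xi)<\infty$ for some $C>0$; it has finite third moments if $\int\|\xi\|^3d\mu(\xi)<\infty$. **Constants (known concentration bound of Fournier–Guillin, taken as given).** $C_t,C'_t,C''_t>0$ depend only on $\nu_t$ and are such that for all $n_t$ and $\rho_{t,0}>0$, $\mathbb P(W_t(\nu_t,\hat\nu_t)>\rho_{t,0})$ is at most $C_t\exp(-C'_tn_t\rho_{t,0}^{\delta_t})\mathbf 1_{\{\rho_{t,0}\le1\}}+C_t\exp(-C'_tn_t\rho_{t,0}^2)\mathbf 1_{\{\rho_{t,0}>1\}}$ if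 $\nu_t$ is sub-Gaussian and $\delta_t\ge3$, and at most $C_t\exp(-C'_tn_t\rho_{t,0}^{\delta_t})\mathbf 1_{\{\rho_{t,0}\le1\}}+C''_t(n_t\rho_{t,0}^2)^{-1}$ if $\nu_t$ has finite third moments. *)

theory Defs
  imports "HOL-Probability.Probability"
begin

definition lsc_on :: "'z::topological_space set \<Rightarrow> ('z \<Rightarrow> ennreal) \<Rightarrow> bool" where
  "lsc_on S F \<longleftrightarrow> (\<forall>z\<in>S. F z \<le> Liminf (at z within S) F)"

definition ennreal_convex_on :: "'z::real_vector set \<Rightarrow> ('z \<Rightarrow> ennreal) \<Rightarrow> bool" where
  "ennreal_convex_on S F \<longleftrightarrow> convex S \<and>
     (\<forall>x\<in>S. \<forall>y\<in>S. \<forall>u\<ge>0. \<forall>v\<ge>0. u + v = 1 \<longrightarrow>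
        F (u *\<^sub>R x + v *\<^sub>R y) \<le> ennreal u * F x + ennreal v * F y)"

text \<open>
  Lipschitz continuity with respect to a distance \<open>d\<close> on \<open>S\<close>. For finite-valued \<open>F\<close> this is
  \<open>\<bar>F \<xi> - F \<eta>\<bar> \<le> L * d \<xi> \<eta>\<close>; the subtraction-free form also makes sense (and is satisfied) when
  \<open>F\<close> is identically \<open>\<infinity>\<close> on \<open>S\<close>.
\<close>
definition ennreal_lipschitz_on :: "'b set \<Rightarrow> ('b \<Rightarrow> 'b \<Rightarrow> real) \<Rightarrow> real \<Rightarrow> ('b \<Rightarrow> ennreal) \<Rightarrow> bool" where
  "ennreal_lipschitz_on S d L F \<longleftrightarrow> 0 \<le> L \<and>
     (\<forall>\<xi>\<in>S. \<forall>\<eta>\<in>S. F \<xi> \<le> F \<eta> + ennreal (L * d \<xi> \<eta>))"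

definition couplings :: "'b measure \<Rightarrow> 'b measure \<Rightarrow> ('b \<times> 'b) measure set" where
  "couplings \<mu> \<nu> = {\<pi>. sets \<pi> = sets (\<mu> \<Otimes>\<^sub>M \<nu>) \<and> distr \<pi> \<mu> fst = \<mu> \<and> distr \<pi> \<nu> snd = \<nu>}"

definition wasserstein :: "('b \<Rightarrow> 'b \<Rightarrow> real) \<Rightarrow> 'b measure \<Rightarrow> 'b measure \<Rightarrow> ennreal" where
  "wasserstein d \<mu> \<nu> = (INF \<pi>\<in>couplings \<mu> \<nu>. \<integral>\<^sup>+z. ennreal (d (fst z) (snd z)) \<partial>\<pi>)"

text \<open>
  Probability measures on \<open>S\<close> live on the trace \<open>restrict_space borel S\<close> of the Borel
  \<open>\<sigma>\<close>-algebra.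
\<close>
definition wasserstein_space ::
    "'b::euclidean_space set \<Rightarrow> ('b \<Rightarrow> 'b \<Rightarrow> real) \<Rightarrow> 'b measure set" where
  "wasserstein_space S d =
     {\<mu>. prob_space \<mu> \<and> sets \<mu> = sets (restrict_space borel S) \<and>
         (\<exists>\<eta>\<in>S. (\<integral>\<^sup>+\<xi>. ennreal (d \<eta> \<xi>) \<partial>\<mu>) < \<infinity>)}"

text \<open>The measure \<open>(1/n) (\<Delta>(s 1) + \<dots> + \<Delta>(s n))\<close>, as the law of \<open>s k\<close> for uniform \<open>k \<in> {1..n}\<close>.\<close>
definition empirical :: "'b::euclidean_space set \<Rightarrow> nat \<Rightarrow> (nat \<Rightarrow> 'b) \<Rightarrow> 'b measure" where
  "empirical S n s = distr (uniform_count_measure {1..n}) (restrict_space borel S) s"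

lemma emeasure_empirical:
  assumes "0 < n" "\<And>k. k \<in> {1..n} \<Longrightarrow> s k \<in> S" "A \<in> sets (restrict_space borel S)"
  shows "emeasure (empirical S n s) A = (\<Sum>k=1..n. emeasure (return (restrict_space borel S) (s k)) A) / of_nat n"
proof -
  have m: "s \<in> uniform_count_measure {1..n} \<rightarrow>\<^sub>M restrict_space borel S"
    using assms(2) by (auto simp: measurable_def space_uniform_count_measure
        sets_uniform_count_measure space_restrict_space)
  have "emeasure (empirical S n s) A = emeasure (uniform_count_measure {1..n}) (s -` A \<inter> {1..n})"
    unfolding empirical_def using m assms(3)
    by (simp add: emeasure_distr space_uniform_count_measure)
  also have "\<dots> = ennreal (real (card (s -` A \<inter> {1..n})) / real n)"
    by (subst emeasure_uniform_count_measure) auto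
  also have "\<dots> = of_nat (card (s -` A \<inter> {1..n})) / of_nat n"
    using assms(1) by (simp flip: divide_ennreal add: ennreal_of_nat_eq_real_of_nat)
  also have "of_nat (card (s -` A \<inter> {1..n})) = (\<Sum>k=1..n. emeasure (return (restrict_space borel S) (s k)) A)"
  proof -
    have "(\<Sum>k=1..n. indicator A (s k) :: ennreal) = (\<Sum>k\<in>{1..n}. if k \<in> s -` A \<inter> {1..n} then 1 else 0)"
      by (intro sum.cong) (auto simp: indicator_def)
    also have "\<dots> = of_nat (card (s -` A \<inter> {1..n}))"
      by (subst sum.If_cases) (auto simp: Int_commute Int_assoc Collect_conj_eq intro!: arg_cong[where f=card])
    finally show ?thesis
      using assms(3) by simp
  qed
  finally show ?thesis .
qed

definition ambiguity_set ::
    "'b::euclidean_space set \<Rightarrow> ('b \<Rightarrow> 'b \<Rightarrow> real) \<Rightarrow> nat \<Rightarrow> (nat \<Rightarrow> 'b \<Rightarrow> real) \<Rightarrow> (nat \<Rightarrow> real)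
      \<Rightarrow> 'b measure \<Rightarrow> 'b measure set" where
  "ambiguity_set S d m g \<rho> \<nu> =
     {p \<in> wasserstein_space S d.
        wasserstein d p \<nu> \<le> ennreal (\<rho> 0) \<and> (\<forall>j\<in>{1..m}. integral\<^sup>L p (g j) \<le> \<rho> j)}"

text \<open>
  The stage-wise Euclidean spaces are regarded as subspaces of common ambient spaces \<open>'a\<close> (states)
  and \<open>'b\<close> (uncertainty): \<open>V t\<close>, of dimension \<open>\<delta> t\<close>, plays the role of \<open>\<real>\<close> to the power \<open>\<delta> t\<close>.
  Joint measurability of \<open>d t\<close> is what makes the integrals defining the Wasserstein distance
  meaningful; no further compatibility with the Euclidean topology is imposed.
\<close>
locale dr_mco =
  fixes T :: nat
    and X :: "nat \<Rightarrow> 'a::euclidean_space set"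
    and x0 :: 'a
    and \<Xi> :: "nat \<Rightarrow> 'b::euclidean_space set"
    and \<xi>1 :: 'b
    and V :: "nat \<Rightarrow> 'b set"
    and \<delta> :: "nat \<Rightarrow> nat"
    and f :: "nat \<Rightarrow> 'a \<Rightarrow> 'a \<Rightarrow> 'b \<Rightarrow> ennreal"
    and d :: "nat \<Rightarrow> 'b \<Rightarrow> 'b \<Rightarrow> real"
    and m :: "nat \<Rightarrow> nat"
    and g :: "nat \<Rightarrow> nat \<Rightarrow> 'b \<Rightarrow> real"
  assumes horizon: "2 \<le> T"
    and convex_states: "\<And>t. t \<in> {1..T} \<Longrightarrow> convex (X t)"
    and initial_state: "X 0 = {x0}"
    and initial_uncertainty: "\<Xi> 1 = {\<xi>1}"
    and uncertainty_space: "\<And>t. t \<in> {1..T} \<Longrightarrow> subspace (V t) \<and> dim (V t) = \<delta> t \<and> \<Xi> t \<subseteq> V t"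
    and cost_lsc: "\<And>t. t \<in> {1..T} \<Longrightarrow>
          lsc_on (X (t - 1) \<times> X t \<times> \<Xi> t) (\<lambda>(x, y, \<xi>). f t x y \<xi>)"
    and cost_convex: "\<And>t \<xi>. t \<in> {1..T} \<Longrightarrow> \<xi> \<in> \<Xi> t \<Longrightarrow>
          ennreal_convex_on (X (t - 1) \<times> X t) (\<lambda>(x, y). f t x y \<xi>)"
    and dist_metric: "\<And>t. t \<in> {1..T} \<Longrightarrow> Metric_space (\<Xi> t) (d t)"
    and dist_measurable: "\<And>t. t \<in> {1..T} \<Longrightarrow>
          (\<lambda>(\<xi>, \<eta>). d t \<xi> \<eta>) \<in> borel_measurable (restrict_space borel (\<Xi> t) \<Otimes>\<^sub>M restrict_space borel (\<Xi> t))"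
    and constraint_continuous: "\<And>t j. t \<in> {2..T} \<Longrightarrow> j \<in> {1..m t} \<Longrightarrow> continuous_on (\<Xi> t) (g t j)"
    and constraint_growth: "\<And>t j. t \<in> {2..T} \<Longrightarrow> j \<in> {1..m t} \<Longrightarrow>
          \<exists>C>0. \<exists>\<eta>\<in>\<Xi> t. \<forall>\<xi>\<in>\<Xi> t. \<bar>g t j \<xi>\<bar> \<le> C * (1 + d t \<eta> \<xi>)"

text \<open>
  \<open>cost_to_go T X f P t\<close> is the worst-case expected cost-to-go after stage \<open>t\<close> for a family
  \<open>P\<close> of ambiguity sets. Values lie in \<open>[0, \<infinity>]\<close>, with \<open>INF\<close> over the empty set equal to \<open>\<infinity>\<close>.
\<close>
function cost_to_go ::
    "nat \<Rightarrow> (nat \<Rightarrow> 'a set) \<Rightarrow> (nat \<Rightarrow> 'a \<Rightarrow> 'a \<Rightarrow> 'b \<Rightarrow> ennreal) \<Rightarrow> (nat \<Rightarrow> 'b measure set)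
      \<Rightarrow> nat \<Rightarrow> 'a \<Rightarrow> ennreal" where
  "cost_to_go T X f P t x =
     (if t < T
      then SUP p\<in>P (Suc t). \<integral>\<^sup>+\<xi>. (INF y\<in>X (Suc t). f (Suc t) x y \<xi> + cost_to_go T X f P (Suc t) y) \<partial>p
      else 0)"
  by pat_completeness auto
termination
  by (relation "Wellfounded.measure (\<lambda>(T, X, f, P, t, x). T - t)") auto

declare cost_to_go.simps [simp del]

definition stage_value ::
    "nat \<Rightarrow> (nat \<Rightarrow> 'a set) \<Rightarrow> (nat \<Rightarrow> 'a \<Rightarrow> 'a \<Rightarrow> 'b \<Rightarrow> ennreal) \<Rightarrow> (nat \<Rightarrow> 'b measure set)
      \<Rightarrow> nat \<Rightarrow> 'a \<Rightarrow> 'b \<Rightarrow> ennreal" where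
  "stage_value T X f P t x \<xi> = (INF y\<in>X t. f t x y \<xi> + cost_to_go T X f P t y)"

function nominal_cost_to_go ::
    "nat \<Rightarrow> (nat \<Rightarrow> 'a set) \<Rightarrow> (nat \<Rightarrow> 'a \<Rightarrow> 'a \<Rightarrow> 'b \<Rightarrow> ennreal) \<Rightarrow> (nat \<Rightarrow> nat) \<Rightarrow> (nat \<Rightarrow> nat \<Rightarrow> 'b)
      \<Rightarrow> nat \<Rightarrow> 'a \<Rightarrow> ennreal" where
  "nominal_cost_to_go T X f n s t x =
     (if t < T
      then (\<Sum>k=1..n (Suc t). INF y\<in>X (Suc t).
              f (Suc t) x y (s (Suc t) k) + nominal_cost_to_go T X f n s (Suc t) y) / of_nat (n (Suc t))
      else 0)"
  by pat_completeness auto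
termination
  by (relation "Wellfounded.measure (\<lambda>(T, X, f, n, s, t, x). T - t)") auto

declare nominal_cost_to_go.simps [simp del]

definition nominal_stage_value ::
    "nat \<Rightarrow> (nat \<Rightarrow> 'a set) \<Rightarrow> (nat \<Rightarrow> 'a \<Rightarrow> 'a \<Rightarrow> 'b \<Rightarrow> ennreal) \<Rightarrow> (nat \<Rightarrow> nat) \<Rightarrow> (nat \<Rightarrow> nat \<Rightarrow> 'b)
      \<Rightarrow> nat \<Rightarrow> 'a \<Rightarrow> 'b \<Rightarrow> ennreal" where
  "nominal_stage_value T X f n s t x \<xi> = (INF y\<in>X t. f t x y \<xi> + nominal_cost_to_go T X f n s t y)"

text \<open>
  Joint measurability of the policy in state and uncertainty is not required, so the integrand need
  not be measurable; \<open>nn_integral\<close> is then the lower integral.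
\<close>
function eval_cost_to_go ::
    "nat \<Rightarrow> (nat \<Rightarrow> 'a \<Rightarrow> 'a \<Rightarrow> 'b \<Rightarrow> ennreal) \<Rightarrow> (nat \<Rightarrow> 'b measure) \<Rightarrow> (nat \<Rightarrow> 'a \<Rightarrow> 'b \<Rightarrow> 'a)
      \<Rightarrow> nat \<Rightarrow> 'a \<Rightarrow> ennreal" where
  "eval_cost_to_go T f \<nu> pol t x =
     (if t < T
      then \<integral>\<^sup>+\<xi>. f (Suc t) x (pol (Suc t) x \<xi>) \<xi>
                + eval_cost_to_go T f \<nu> pol (Suc t) (pol (Suc t) x \<xi>) \<partial>\<nu> (Suc t)
      else 0)"
  by pat_completeness auto
termination
  by (relation "Wellfounded.measure (\<lambda>(T, f, \<nu>, pol, t, x). T - t)") auto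

declare eval_cost_to_go.simps [simp del]

definition eval_value ::
    "nat \<Rightarrow> (nat \<Rightarrow> 'a \<Rightarrow> 'a \<Rightarrow> 'b \<Rightarrow> ennreal) \<Rightarrow> (nat \<Rightarrow> 'b measure) \<Rightarrow> 'a \<Rightarrow> 'b
      \<Rightarrow> 'a \<Rightarrow> (nat \<Rightarrow> 'a \<Rightarrow> 'b \<Rightarrow> 'a) \<Rightarrow> ennreal" where
  "eval_value T f \<nu> x0 \<xi>1 y1 pol = f 1 x0 y1 \<xi>1 + eval_cost_to_go T f \<nu> pol 1 y1"

definition optimal_policy ::
    "nat \<Rightarrow> (nat \<Rightarrow> 'a::euclidean_space set) \<Rightarrow> (nat \<Rightarrow> 'b::euclidean_space set)
      \<Rightarrow> (nat \<Rightarrow> 'a \<Rightarrow> 'a \<Rightarrow> 'b \<Rightarrow> ennreal) \<Rightarrow> (nat \<Rightarrow> 'b measure set)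
      \<Rightarrow> 'a \<Rightarrow> 'b \<Rightarrow> 'a \<Rightarrow> (nat \<Rightarrow> 'a \<Rightarrow> 'b \<Rightarrow> 'a) \<Rightarrow> bool" where
  "optimal_policy T X \<Xi> f P x0 \<xi>1 y1 pol \<longleftrightarrow>
     is_arg_min (\<lambda>y. f 1 x0 y \<xi>1 + cost_to_go T X f P 1 y) (\<lambda>y. y \<in> X 1) y1 \<and>
     (\<forall>t\<in>{2..T}. \<forall>x\<in>X (t - 1).
        pol t x \<in> borel_measurable (restrict_space borel (\<Xi> t)) \<and>
        (\<forall>\<xi>\<in>\<Xi> t. is_arg_min (\<lambda>y. f t x y \<xi> + cost_to_go T X f P t y) (\<lambda>y. y \<in> X t) (pol t x \<xi>)))"

text \<open>The ambiguity sets built from the samples \<open>s t 1, \<dots>, s t (n t)\<close>.\<close>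
definition dr_ambiguity ::
    "(nat \<Rightarrow> 'b::euclidean_space set) \<Rightarrow> (nat \<Rightarrow> 'b \<Rightarrow> 'b \<Rightarrow> real) \<Rightarrow> (nat \<Rightarrow> nat) \<Rightarrow> (nat \<Rightarrow> nat)
      \<Rightarrow> (nat \<Rightarrow> nat \<Rightarrow> 'b \<Rightarrow> real) \<Rightarrow> (nat \<Rightarrow> nat \<Rightarrow> real) \<Rightarrow> (nat \<Rightarrow> nat \<Rightarrow> 'b) \<Rightarrow> nat \<Rightarrow> 'b measure set" where
  "dr_ambiguity \<Xi> d n m g \<rho> s t =
     ambiguity_set (\<Xi> t) (d t) (m t) (g t) (\<rho> t) (empirical (\<Xi> t) (n t) (s t))"

definition lipschitz_in_uncertainty ::
    "nat \<Rightarrow> (nat \<Rightarrow> 'a set) \<Rightarrow> (nat \<Rightarrow> 'b set) \<Rightarrow> (nat \<Rightarrow> 'b \<Rightarrow> 'b \<Rightarrow> real) \<Rightarrow> (nat \<Rightarrow> real)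
      \<Rightarrow> (nat \<Rightarrow> 'a \<Rightarrow> 'b \<Rightarrow> ennreal) \<Rightarrow> bool" where
  "lipschitz_in_uncertainty T X \<Xi> d l Q \<longleftrightarrow>
     (\<forall>t\<in>{1..T}. \<forall>x\<in>X (t - 1). ennreal_lipschitz_on (\<Xi> t) (d t) (l t) (Q t x))"

definition strictly_feasible ::
    "nat \<Rightarrow> (nat \<Rightarrow> 'b::euclidean_space set) \<Rightarrow> (nat \<Rightarrow> nat) \<Rightarrow> (nat \<Rightarrow> nat)
      \<Rightarrow> (nat \<Rightarrow> nat \<Rightarrow> 'b \<Rightarrow> real) \<Rightarrow> (nat \<Rightarrow> nat \<Rightarrow> real) \<Rightarrow> (nat \<Rightarrow> nat \<Rightarrow> 'b) \<Rightarrow> bool" where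
  "strictly_feasible T \<Xi> n m g \<rho> s \<longleftrightarrow>
     (\<forall>t\<in>{2..T}. 0 < \<rho> t 0 \<and>
        (\<forall>j\<in>{1..m t}. integral\<^sup>L (empirical (\<Xi> t) (n t) (s t)) (g t j) < \<rho> t j))"

definition sub_gaussian :: "'b::euclidean_space set \<Rightarrow> 'b measure \<Rightarrow> bool" where
  "sub_gaussian V \<mu> \<longleftrightarrow>
     (\<exists>C>0. (SUP u\<in>{u\<in>V. norm u = 1}. \<integral>\<^sup>+\<xi>. ennreal (exp (C * (u \<bullet> \<xi>)\<^sup>2)) \<partial>\<mu>) < \<infinity>)"

definition finite_third_moments :: "'b::euclidean_space measure \<Rightarrow> bool" where
  "finite_third_moments \<mu> \<longleftrightarrow> (\<integral>\<^sup>+\<xi>. ennreal (norm \<xi> ^ 3) \<partial>\<mu>) < \<infinity>"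

text \<open>
  Probability that the empirical measure of \<open>n\<close> i.i.d. samples of \<open>\<nu>\<close> is at Wasserstein distance
  more than \<open>r\<close> from \<open>\<nu>\<close>. The outer measure agrees with the probability whenever the event is
  measurable; the plain measure of a non-measurable set would be \<open>0\<close> by convention.
\<close>
definition deviation_prob ::
    "'b::euclidean_space set \<Rightarrow> ('b \<Rightarrow> 'b \<Rightarrow> real) \<Rightarrow> 'b measure \<Rightarrow> nat \<Rightarrow> real \<Rightarrow> ennreal" where
  "deviation_prob S d \<nu> n r =
     (let N = PiM {1..n} (\<lambda>_. \<nu>)
      in outer_measure_of N {s \<in> space N. wasserstein d \<nu> (empirical S n s) > ennreal r})"

definition concentration_constants ::
    "'b::euclidean_space set \<Rightarrow> nat \<Rightarrow> 'b set \<Rightarrow> ('b \<Rightarrow> 'b \<Rightarrow> real) \<Rightarrow> 'b measure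
      \<Rightarrow> real \<Rightarrow> real \<Rightarrow> real \<Rightarrow> bool" where
  "concentration_constants V \<delta> S d \<nu> C C' C'' \<longleftrightarrow>
     0 < C \<and> 0 < C' \<and> 0 < C'' \<and>
     (sub_gaussian V \<nu> \<and> 3 \<le> \<delta> \<longrightarrow>
        (\<forall>n\<ge>1. \<forall>r>0. deviation_prob S d \<nu> n r \<le> ennreal
           (C * exp (- C' * real n * r ^ \<delta>) * of_bool (r \<le> 1) + C * exp (- C' * real n * r\<^sup>2) * of_bool (r > 1)))) \<and>
     (finite_third_moments \<nu> \<longrightarrow>
        (\<forall>n\<ge>1. \<forall>r>0. deviation_prob S d \<nu> n r \<le> ennreal
           (C * exp (- C' * real n * r ^ \<delta>) * of_bool (r \<le> 1) + C'' / (real n * r\<^sup>2))))"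

end

theory Submission
  imports Defs
begin

text \<open>
  The engine is the easy half of Kantorovich--Rubinstein duality: if two measures are within
  Wasserstein distance \<open>r\<close>, the integrals of an \<open>L\<close>-Lipschitz function against them differ by at most
  \<open>L * r\<close>. In the distributionally robust recursion, every measure in the ambiguity set of stage \<open>t\<close>
  is within \<open>\<rho> t 0\<close> of the empirical measure, so passing from the worst case to the sample average
  loses at most \<open>l t * \<rho> t 0\<close> per stage. Since constants commute with infima and averages, backward
  induction adds up these losses (\<open>cost_to_go_le_nominal\<close>).

  For the out-of-sample bound, the same induction is run between the nominal problem and the
  evaluation of the policy under the true distributions (\<open>nominal_cost_to_go_le_eval\<close>). It is valid on
  the event that the empirical measure of every stage is within \<open>\<rho> t 0\<close> of the true one, and the
  two losses combine to the factor \<open>2\<close>. By the concentration bound and the choice of the sample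
  sizes, each stage satisfies this with probability at least \<open>\<alpha> powr (1 / (T - 1))\<close>
  (\<open>deviation_prob_le\<close>), and independence of the stages gives probability \<open>\<alpha>\<close> for all of them
  (\<open>prob_all_stages_close\<close>).

  The delicate point is measurability. The distances are jointly measurable but need not be
  compatible with the Euclidean topology, so a value function that is Lipschitz in the uncertainty
  need not be Borel measurable (for the discrete distance every function with values in \<open>[0, 1]\<close> is
  Lipschitz), and its integral is only a lower integral. What rescues the argument is that one of the
  two measures is always empirical: the value function may be replaced by its largest or smallest
  Lipschitz extension from the finite set of samples, which is measurable, agrees with it at the
  samples, and bounds it from the required side (\<open>sample_average_lipschitz_bound\<close>).
\<close>

section \<open>Lower integrals and sample averages\<close>

lemma INF_add_const_ennreal:
  fixes h :: "'i \<Rightarrow> ennreal"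
  shows "(INF i\<in>I. h i + c) = (INF i\<in>I. h i) + c"
proof (cases "c = top")
  case False
  show ?thesis
  proof (rule antisym)
    have "(INF i\<in>I. h i + c) - c \<le> (INF i\<in>I. h i)"
      using False by (intro INF_greatest) (auto simp: ennreal_minus_le_iff add.commute intro: INF_lower)
    then show "(INF i\<in>I. h i + c) \<le> (INF i\<in>I. h i) + c"
      using False by (auto simp: ennreal_minus_le_iff add.commute)
  qed (auto intro!: INF_greatest add_right_mono INF_lower)
qed simp

text \<open>
  For a non-measurable \<open>h\<close> the integral is a lower one, which in general is only superadditive.
  Adding a constant is harmless: a simple function below \<open>h + c\<close> becomes one below \<open>h\<close> after
  truncated subtraction of \<open>c\<close>.
\<close>
lemma nn_integral_add_const_le:
  fixes h :: "'c \<Rightarrow> ennreal"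
  assumes "prob_space p"
  shows "(\<integral>\<^sup>+\<xi>. h \<xi> + c \<partial>p) \<le> (\<integral>\<^sup>+\<xi>. h \<xi> \<partial>p) + c"
proof (cases "c = top")
  case False
  interpret prob_space p by fact
  show ?thesis
    unfolding nn_integral_def[of p "\<lambda>\<xi>. h \<xi> + c"]
  proof (safe intro!: SUP_least)
    fix u assume u: "simple_function p u" "u \<le> (\<lambda>\<xi>. h \<xi> + c)"
    have [measurable]: "u \<in> borel_measurable p"
      using u(1) by (rule borel_measurable_simple_function)
    have "integral\<^sup>S p u = (\<integral>\<^sup>+\<xi>. u \<xi> \<partial>p)"
      using u(1) by (simp add: nn_integral_eq_simple_integral)
    also have "\<dots> \<le> (\<integral>\<^sup>+\<xi>. (u \<xi> - c) + c \<partial>p)"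
      by (intro nn_integral_mono) (auto simp: diff_add_self_ennreal)
    also have "\<dots> = (\<integral>\<^sup>+\<xi>. u \<xi> - c \<partial>p) + c"
      by (subst nn_integral_add) (auto simp: emeasure_space_1)
    also have "\<dots> \<le> (\<integral>\<^sup>+\<xi>. h \<xi> \<partial>p) + c"
      using u(2) False
      by (intro add_right_mono nn_integral_mono) (auto simp: ennreal_minus_le_iff le_fun_def add.commute)
    finally show "integral\<^sup>S p u \<le> (\<integral>\<^sup>+\<xi>. h \<xi> \<partial>p) + c" .
  qed
qed simp

lemma average_add_const:
  fixes a :: "nat \<Rightarrow> ennreal"
  assumes "1 \<le> n"
  shows "(\<Sum>k=1..n. a k + c) / of_nat n = (\<Sum>k=1..n. a k) / of_nat n + c"
proof -
  have "c * of_nat n / of_nat n = c"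
    using assms by (intro mult_divide_eq_ennreal) auto
  then show ?thesis
    by (simp add: sum.distrib add_divide_distrib_ennreal mult.commute)
qed

lemma nn_integral_empirical:
  assumes "1 \<le> n" "\<And>k. k \<in> {1..n} \<Longrightarrow> s k \<in> S" "h \<in> borel_measurable (restrict_space borel S)"
  shows "(\<integral>\<^sup>+\<xi>. h \<xi> \<partial>empirical S n s) = (\<Sum>k=1..n. h (s k)) / of_nat n"
proof -
  have "s \<in> uniform_count_measure {1..n} \<rightarrow>\<^sub>M restrict_space borel S"
    using assms(2) by (auto simp: measurable_def space_uniform_count_measure
        sets_uniform_count_measure space_restrict_space)
  then have "(\<integral>\<^sup>+\<xi>. h \<xi> \<partial>empirical S n s) = (\<integral>\<^sup>+k. h (s k) \<partial>uniform_count_measure {1..n})"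
    unfolding empirical_def using assms(3) by (intro nn_integral_distr) simp_all
  also have "\<dots> = (\<Sum>k=1..n. h (s k) * ennreal (1 / real n))"
    unfolding uniform_count_measure_def by (simp add: nn_integral_point_measure_finite mult.commute)
  also have "ennreal (1 / real n) = 1 / of_nat n"
    using assms(1) by (simp flip: divide_ennreal add: ennreal_of_nat_eq_real_of_nat)
  also have "(\<Sum>k=1..n. h (s k) * (1 / of_nat n)) = (\<Sum>k=1..n. h (s k)) / of_nat n"
    unfolding sum_distrib_right[symmetric] by (simp add: ennreal_times_divide)
  finally show ?thesis .
qed

section \<open>Lipschitz functions and the Wasserstein distance to an empirical measure\<close>

locale measurable_metric = Metric_space S d
  for S :: "'b::euclidean_space set" and d +
  assumes joint_measurable:
    "(\<lambda>(\<xi>, \<eta>). d \<xi> \<eta>) \<in> borel_measurable (restrict_space borel S \<Otimes>\<^sub>M restrict_space borel S)"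
begin

lemma measurable_dist_from:
  assumes "\<xi> \<in> S"
  shows "d \<xi> \<in> borel_measurable (restrict_space borel S)"
proof -
  have "(\<lambda>\<eta>. (\<lambda>(\<xi>, \<eta>). d \<xi> \<eta>) (\<xi>, \<eta>)) \<in> borel_measurable (restrict_space borel S)"
    using assms by (intro measurable_compose[OF _ joint_measurable]) (simp add: space_restrict_space)
  then show ?thesis by simp
qed

text \<open>
  The easy half of Kantorovich--Rubinstein duality: both integrals are integrals over the coupling,
  where the integrands differ by at most \<open>L\<close> times the transport cost. Measurability of \<open>h\<close> is
  essential here, since a lower integral may increase when \<open>h\<close> is pulled back to the product space.
\<close>
lemma coupling_lipschitz_bound:
  assumes \<pi>: "\<pi> \<in> couplings p q"
    and sets: "sets p = sets (restrict_space borel S)" "sets q = sets (restrict_space borel S)"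
    and h: "h \<in> borel_measurable (restrict_space borel S)"
    and lip: "ennreal_lipschitz_on S d L h"
  shows "(\<integral>\<^sup>+\<xi>. h \<xi> \<partial>p) \<le> (\<integral>\<^sup>+\<xi>. h \<xi> \<partial>q) + ennreal L * (\<integral>\<^sup>+z. ennreal (d (fst z) (snd z)) \<partial>\<pi>)"
    and "(\<integral>\<^sup>+\<xi>. h \<xi> \<partial>q) \<le> (\<integral>\<^sup>+\<xi>. h \<xi> \<partial>p) + ennreal L * (\<integral>\<^sup>+z. ennreal (d (fst z) (snd z)) \<partial>\<pi>)"
proof -
  have sets\<pi>: "sets \<pi> = sets (p \<Otimes>\<^sub>M q)" and p: "distr \<pi> p fst = p" and q: "distr \<pi> q snd = q"
    using \<pi> by (auto simp: couplings_def)
  have prod: "sets (p \<Otimes>\<^sub>M q) = sets (restrict_space borel S \<Otimes>\<^sub>M restrict_space borel S)"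
    by (intro sets_pair_measure_cong sets)
  have [measurable]: "h \<in> borel_measurable p" "h \<in> borel_measurable q"
    using h measurable_cong_sets[OF sets(1) refl] measurable_cong_sets[OF sets(2) refl] by auto
  have [measurable]: "fst \<in> \<pi> \<rightarrow>\<^sub>M p" "snd \<in> \<pi> \<rightarrow>\<^sub>M q"
    by (simp_all add: measurable_cong_sets[OF sets\<pi> refl])
  have [measurable]: "(\<lambda>z. d (fst z) (snd z)) \<in> borel_measurable \<pi>"
    using joint_measurable by (simp add: measurable_cong_sets[OF sets\<pi> refl] measurable_cong_sets[OF prod refl] case_prod_beta')
  have int_p: "(\<integral>\<^sup>+\<xi>. h \<xi> \<partial>p) = (\<integral>\<^sup>+z. h (fst z) \<partial>\<pi>)"
    by (subst p[symmetric], subst nn_integral_distr) simp_all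
  have int_q: "(\<integral>\<^sup>+\<xi>. h \<xi> \<partial>q) = (\<integral>\<^sup>+z. h (snd z) \<partial>\<pi>)"
    by (subst q[symmetric], subst nn_integral_distr) simp_all
  have space: "fst z \<in> S \<and> snd z \<in> S" if "z \<in> space \<pi>" for z
  proof -
    have "space \<pi> = S \<times> S"
      unfolding sets_eq_imp_space_eq[OF sets\<pi>] sets_eq_imp_space_eq[OF prod]
      by (simp add: space_pair_measure space_restrict_space)
    then show ?thesis
      using that by (simp only: mem_Times_iff)
  qed
  have L: "0 \<le> L"
    using lip by (simp add: ennreal_lipschitz_on_def)
  have close: "h (fst z) \<le> h (snd z) + ennreal L * ennreal (d (fst z) (snd z))"
    "h (snd z) \<le> h (fst z) + ennreal L * ennreal (d (fst z) (snd z))" if "z \<in> space \<pi>" for z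
    using lip space[OF that] unfolding ennreal_lipschitz_on_def ennreal_mult'[OF L, symmetric]
    by (blast, metis commute)
  have "(\<integral>\<^sup>+z. h (fst z) \<partial>\<pi>) \<le> (\<integral>\<^sup>+z. h (snd z) + ennreal L * ennreal (d (fst z) (snd z)) \<partial>\<pi>)"
    by (intro nn_integral_mono close)
  then show "(\<integral>\<^sup>+\<xi>. h \<xi> \<partial>p) \<le> (\<integral>\<^sup>+\<xi>. h \<xi> \<partial>q) + ennreal L * (\<integral>\<^sup>+z. ennreal (d (fst z) (snd z)) \<partial>\<pi>)"
    unfolding int_p int_q by (simp add: nn_integral_add nn_integral_cmult)
  have "(\<integral>\<^sup>+z. h (snd z) \<partial>\<pi>) \<le> (\<integral>\<^sup>+z. h (fst z) + ennreal L * ennreal (d (fst z) (snd z)) \<partial>\<pi>)"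
    by (intro nn_integral_mono close)
  then show "(\<integral>\<^sup>+\<xi>. h \<xi> \<partial>q) \<le> (\<integral>\<^sup>+\<xi>. h \<xi> \<partial>p) + ennreal L * (\<integral>\<^sup>+z. ennreal (d (fst z) (snd z)) \<partial>\<pi>)"
    unfolding int_p int_q by (simp add: nn_integral_add nn_integral_cmult)
qed

lemma wasserstein_near_optimal_coupling:
  assumes "wasserstein d p q \<le> ennreal r" "0 \<le> r" "0 < e"
  obtains \<pi> where "\<pi> \<in> couplings p q" "(\<integral>\<^sup>+z. ennreal (d (fst z) (snd z)) \<partial>\<pi>) \<le> ennreal (r + e)"
proof -
  have "wasserstein d p q < ennreal (r + e)"
    using assms by (intro le_less_trans[OF assms(1)]) (simp add: ennreal_less_iff)
  then show ?thesis
    unfolding wasserstein_def INF_less_iff using that by (auto intro: less_imp_le)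
qed

lemma wasserstein_lipschitz_bound:
  assumes W: "wasserstein d p q \<le> ennreal r" and r: "0 \<le> r"
    and sets: "sets p = sets (restrict_space borel S)" "sets q = sets (restrict_space borel S)"
    and h: "h \<in> borel_measurable (restrict_space borel S)"
    and lip: "ennreal_lipschitz_on S d L h"
  shows "(\<integral>\<^sup>+\<xi>. h \<xi> \<partial>p) \<le> (\<integral>\<^sup>+\<xi>. h \<xi> \<partial>q) + ennreal (L * r)"
    and "(\<integral>\<^sup>+\<xi>. h \<xi> \<partial>q) \<le> (\<integral>\<^sup>+\<xi>. h \<xi> \<partial>p) + ennreal (L * r)"
proof -
  have L: "0 \<le> L"
    using lip by (simp add: ennreal_lipschitz_on_def)
  have limit: "a \<le> b + ennreal (L * r)"
    if bound: "\<And>\<pi>. \<pi> \<in> couplings p q \<Longrightarrow> a \<le> b + ennreal L * (\<integral>\<^sup>+z. ennreal (d (fst z) (snd z)) \<partial>\<pi>)"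
    for a b :: ennreal
  proof (rule ennreal_le_epsilon)
    fix e :: real assume e: "0 < e"
    \<comment> \<open>Dividing by \<open>L + 1\<close> instead of \<open>L\<close> also covers \<open>L = 0\<close>.\<close>
    then have "0 < e / (L + 1)"
      using L by simp
    then obtain \<pi> where \<pi>: "\<pi> \<in> couplings p q"
        "(\<integral>\<^sup>+z. ennreal (d (fst z) (snd z)) \<partial>\<pi>) \<le> ennreal (r + e / (L + 1))"
      using wasserstein_near_optimal_coupling[OF W r] by blast
    have "a \<le> b + ennreal L * ennreal (r + e / (L + 1))"
      using bound[OF \<pi>(1)] by (rule order_trans) (intro add_left_mono mult_left_mono \<pi>(2), simp)
    also have "\<dots> = b + ennreal (L * (r + e / (L + 1)))"
      using L by (simp add: ennreal_mult')
    also have "\<dots> \<le> b + ennreal (L * r + e)"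
      using L e by (intro add_left_mono ennreal_leI) (simp add: field_simps)
    also have "\<dots> = b + ennreal (L * r) + ennreal e"
      using L r e by (simp add: add.assoc)
    finally show "a \<le> b + ennreal (L * r) + ennreal e" .
  qed
  show "(\<integral>\<^sup>+\<xi>. h \<xi> \<partial>p) \<le> (\<integral>\<^sup>+\<xi>. h \<xi> \<partial>q) + ennreal (L * r)"
    by (rule limit) (rule coupling_lipschitz_bound(1)[OF _ sets h lip])
  show "(\<integral>\<^sup>+\<xi>. h \<xi> \<partial>q) \<le> (\<integral>\<^sup>+\<xi>. h \<xi> \<partial>p) + ennreal (L * r)"
    by (rule limit) (rule coupling_lipschitz_bound(2)[OF _ sets h lip])
qed

text \<open>
  The McShane extension \<open>\<xi> \<mapsto> min a. Q a + L * d a \<xi>\<close> of \<open>Q\<close> restricted to a finite set \<open>F\<close> is the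
  largest \<open>L\<close>-Lipschitz function that agrees with \<open>Q\<close> on \<open>F\<close>. Unlike \<open>Q\<close> it is measurable, because
  it is built from finitely many functions \<open>d a\<close>.
\<close>
lemma lipschitz_upper_extension:
  fixes Q :: "'b \<Rightarrow> ennreal"
  assumes lip: "ennreal_lipschitz_on S d L Q"
    and F: "finite F" "F \<subseteq> S"
  obtains u where "u \<in> borel_measurable (restrict_space borel S)" "ennreal_lipschitz_on S d L u"
    "\<And>\<xi>. \<xi> \<in> S \<Longrightarrow> Q \<xi> \<le> u \<xi>" "\<And>a. a \<in> F \<Longrightarrow> u a = Q a"
proof
  define u where "u \<xi> = (INF a\<in>F. Q a + ennreal (L * d a \<xi>))" for \<xi>
  have L: "0 \<le> L" and lip': "\<And>\<xi> \<eta>. \<xi> \<in> S \<Longrightarrow> \<eta> \<in> S \<Longrightarrow> Q \<xi> \<le> Q \<eta> + ennreal (L * d \<xi> \<eta>)"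
    using lip by (auto simp: ennreal_lipschitz_on_def)
  show "u \<in> borel_measurable (restrict_space borel S)"
    unfolding u_def
  proof (rule borel_measurable_INF)
    fix a assume "a \<in> F"
    then have [measurable]: "d a \<in> borel_measurable (restrict_space borel S)"
      using F by (intro measurable_dist_from) auto
    show "(\<lambda>\<xi>. Q a + ennreal (L * d a \<xi>)) \<in> borel_measurable (restrict_space borel S)"
      by measurable
  qed (use F in \<open>auto intro: countable_finite\<close>)
  show below: "Q \<xi> \<le> u \<xi>" if "\<xi> \<in> S" for \<xi>
    unfolding u_def using that F lip'[of \<xi>] by (intro INF_greatest) (auto simp: subset_iff commute[of \<xi>])
  show "u a = Q a" if "a \<in> F" for a
  proof (rule antisym)
    show "u a \<le> Q a"
      unfolding u_def using that F by (intro INF_lower2[of a]) (auto simp: subset_iff)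
    show "Q a \<le> u a"
      using that F by (intro below) auto
  qed
  have "u \<xi> \<le> u \<eta> + ennreal (L * d \<xi> \<eta>)" if "\<xi> \<in> S" "\<eta> \<in> S" for \<xi> \<eta>
  proof -
    have "u \<xi> \<le> (INF a\<in>F. Q a + ennreal (L * d a \<eta>) + ennreal (L * d \<xi> \<eta>))"
      unfolding u_def
    proof (intro INF_mono)
      fix a assume a: "a \<in> F"
      have "L * d a \<xi> \<le> L * d a \<eta> + L * d \<xi> \<eta>"
        using mult_left_mono[OF triangle[of a \<eta> \<xi>] L] a F that by (auto simp: commute distrib_left)
      then have "ennreal (L * d a \<xi>) \<le> ennreal (L * d a \<eta>) + ennreal (L * d \<xi> \<eta>)"
        using L by (simp flip: ennreal_plus add: ennreal_leI)
      then show "\<exists>b\<in>F. Q b + ennreal (L * d b \<xi>) \<le> Q a + ennreal (L * d a \<eta>) + ennreal (L * d \<xi> \<eta>)"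
        using a by (intro bexI[of _ a]) (simp_all add: add.assoc add_left_mono)
    qed
    also have "\<dots> = u \<eta> + ennreal (L * d \<xi> \<eta>)"
      unfolding u_def by (rule INF_add_const_ennreal)
    finally show ?thesis .
  qed
  then show "ennreal_lipschitz_on S d L u"
    using L by (simp add: ennreal_lipschitz_on_def)
qed

text \<open>
  The dual extension \<open>\<xi> \<mapsto> max a. Q a - L * d a \<xi>\<close> is the smallest such function. Truncating the
  subtraction at \<open>0\<close> preserves the Lipschitz bound.
\<close>
lemma lipschitz_lower_extension:
  fixes Q :: "'b \<Rightarrow> ennreal"
  assumes lip: "ennreal_lipschitz_on S d L Q"
    and F: "finite F" "F \<subseteq> S"
  obtains v where "v \<in> borel_measurable (restrict_space borel S)" "ennreal_lipschitz_on S d L v"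
    "\<And>\<xi>. \<xi> \<in> S \<Longrightarrow> v \<xi> \<le> Q \<xi>" "\<And>a. a \<in> F \<Longrightarrow> v a = Q a"
proof
  define v where "v \<xi> = (SUP a\<in>F. Q a - ennreal (L * d a \<xi>))" for \<xi>
  have L: "0 \<le> L" and lip': "\<And>\<xi> \<eta>. \<xi> \<in> S \<Longrightarrow> \<eta> \<in> S \<Longrightarrow> Q \<xi> \<le> Q \<eta> + ennreal (L * d \<xi> \<eta>)"
    using lip by (auto simp: ennreal_lipschitz_on_def)
  show "v \<in> borel_measurable (restrict_space borel S)"
    unfolding v_def
  proof (rule borel_measurable_SUP)
    fix a assume "a \<in> F"
    then have [measurable]: "d a \<in> borel_measurable (restrict_space borel S)"
      using F by (intro measurable_dist_from) auto
    show "(\<lambda>\<xi>. Q a - ennreal (L * d a \<xi>)) \<in> borel_measurable (restrict_space borel S)"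
      by measurable
  qed (use F in \<open>auto intro: countable_finite\<close>)
  show above: "v \<xi> \<le> Q \<xi>" if "\<xi> \<in> S" for \<xi>
    unfolding v_def using that F lip'
    by (intro SUP_least) (auto simp: ennreal_minus_le_iff add.commute)
  show "v a = Q a" if "a \<in> F" for a
  proof (rule antisym)
    show "Q a \<le> v a"
      unfolding v_def using that F by (intro SUP_upper2[of a]) (auto simp: subset_iff)
    show "v a \<le> Q a"
      using that F by (intro above) auto
  qed
  have "v \<xi> \<le> v \<eta> + ennreal (L * d \<xi> \<eta>)" if "\<xi> \<in> S" "\<eta> \<in> S" for \<xi> \<eta>
    unfolding v_def
  proof (intro SUP_least)
    fix a assume a: "a \<in> F"
    have "L * d a \<eta> \<le> L * d a \<xi> + L * d \<xi> \<eta>"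
      using mult_left_mono[OF triangle[of a \<xi> \<eta>] L] a F that by (auto simp: distrib_left)
    then have le: "ennreal (L * d a \<eta>) \<le> ennreal (L * d a \<xi>) + ennreal (L * d \<xi> \<eta>)"
      using L by (simp flip: ennreal_plus add: ennreal_leI)
    have "Q a \<le> (Q a - ennreal (L * d a \<eta>)) + ennreal (L * d a \<eta>)"
      by (auto simp: diff_add_self_ennreal)
    also have "\<dots> \<le> (Q a - ennreal (L * d a \<eta>)) + (ennreal (L * d a \<xi>) + ennreal (L * d \<xi> \<eta>))"
      using le by (rule add_left_mono)
    finally have "Q a - ennreal (L * d a \<xi>) \<le> (Q a - ennreal (L * d a \<eta>)) + ennreal (L * d \<xi> \<eta>)"
      by (simp add: ennreal_minus_le_iff ac_simps)
    also have "\<dots> \<le> (SUP a\<in>F. Q a - ennreal (L * d a \<eta>)) + ennreal (L * d \<xi> \<eta>)"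
      using a by (intro add_right_mono SUP_upper)
    finally show "Q a - ennreal (L * d a \<xi>) \<le> (SUP a\<in>F. Q a - ennreal (L * d a \<eta>)) + ennreal (L * d \<xi> \<eta>)" .
  qed
  then show "ennreal_lipschitz_on S d L v"
    using L by (simp add: ennreal_lipschitz_on_def)
qed

text \<open>
  An empirical measure sees \<open>Q\<close> only at the samples, where the two measurable extensions of \<open>Q\<close>
  from the set of samples agree with \<open>Q\<close>, so duality applies to them instead of \<open>Q\<close>. The upper one dominates \<open>Q\<close> and
  gives the first bound; the lower one lies below \<open>Q\<close>, hence its integral is at most the lower
  integral of \<open>Q\<close>, which gives the second.
\<close>
lemma sample_average_lipschitz_bound:
  fixes Q :: "'b \<Rightarrow> ennreal"
  assumes W: "wasserstein d p (empirical S n s) \<le> ennreal r" and r: "0 \<le> r"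
    and p: "sets p = sets (restrict_space borel S)"
    and s: "1 \<le> n" "\<And>k. k \<in> {1..n} \<Longrightarrow> s k \<in> S"
    and lip: "ennreal_lipschitz_on S d L Q"
  shows "(\<integral>\<^sup>+\<xi>. Q \<xi> \<partial>p) \<le> (\<Sum>k=1..n. Q (s k)) / of_nat n + ennreal (L * r)"
    and "(\<Sum>k=1..n. Q (s k)) / of_nat n \<le> (\<integral>\<^sup>+\<xi>. Q \<xi> \<partial>p) + ennreal (L * r)"
proof -
  have q: "sets (empirical S n s) = sets (restrict_space borel S)"
    by (simp add: empirical_def)
  have space: "space p = S"
    using sets_eq_imp_space_eq[OF p] by (simp add: space_restrict_space)
  have average: "(\<integral>\<^sup>+\<xi>. h \<xi> \<partial>empirical S n s) = (\<Sum>k=1..n. h (s k)) / of_nat n"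
    if "h \<in> borel_measurable (restrict_space borel S)" for h
    using s that by (rule nn_integral_empirical)
  have F: "finite (s ` {1..n})" "s ` {1..n} \<subseteq> S"
    using s by auto
  obtain u where u: "u \<in> borel_measurable (restrict_space borel S)" "ennreal_lipschitz_on S d L u"
    "\<And>\<xi>. \<xi> \<in> S \<Longrightarrow> Q \<xi> \<le> u \<xi>" "\<And>a. a \<in> s ` {1..n} \<Longrightarrow> u a = Q a"
    using lipschitz_upper_extension[OF lip F] by blast
  have "(\<integral>\<^sup>+\<xi>. Q \<xi> \<partial>p) \<le> (\<integral>\<^sup>+\<xi>. u \<xi> \<partial>p)"
    using u(3) by (intro nn_integral_mono) (simp add: space)
  also have "\<dots> \<le> (\<integral>\<^sup>+\<xi>. u \<xi> \<partial>empirical S n s) + ennreal (L * r)"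
    by (rule wasserstein_lipschitz_bound(1)[OF W r p q u(1,2)])
  also have "(\<integral>\<^sup>+\<xi>. u \<xi> \<partial>empirical S n s) = (\<Sum>k=1..n. Q (s k)) / of_nat n"
    unfolding average[OF u(1)] using u(4) by (intro arg_cong2[where f = divide] sum.cong) simp_all
  finally show "(\<integral>\<^sup>+\<xi>. Q \<xi> \<partial>p) \<le> (\<Sum>k=1..n. Q (s k)) / of_nat n + ennreal (L * r)" .
  obtain v where v: "v \<in> borel_measurable (restrict_space borel S)" "ennreal_lipschitz_on S d L v"
    "\<And>\<xi>. \<xi> \<in> S \<Longrightarrow> v \<xi> \<le> Q \<xi>" "\<And>a. a \<in> s ` {1..n} \<Longrightarrow> v a = Q a"
    using lipschitz_lower_extension[OF lip F] by blast
  have "(\<Sum>k=1..n. Q (s k)) / of_nat n = (\<integral>\<^sup>+\<xi>. v \<xi> \<partial>empirical S n s)"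
    unfolding average[OF v(1)] using v(4) by (intro arg_cong2[where f = divide] sum.cong) simp_all
  also have "\<dots> \<le> (\<integral>\<^sup>+\<xi>. v \<xi> \<partial>p) + ennreal (L * r)"
    by (rule wasserstein_lipschitz_bound(2)[OF W r p q v(1,2)])
  also have "\<dots> \<le> (\<integral>\<^sup>+\<xi>. Q \<xi> \<partial>p) + ennreal (L * r)"
    using v(3) by (intro add_right_mono nn_integral_mono) (simp add: space)
  finally show "(\<Sum>k=1..n. Q (s k)) / of_nat n \<le> (\<integral>\<^sup>+\<xi>. Q \<xi> \<partial>p) + ennreal (L * r)" .
qed

end

section \<open>Comparison of the dynamic programming recursions\<close>

lemma sum_greaterThanAtMost_head:
  fixes a :: "nat \<Rightarrow> ennreal"
  assumes "t < T"
  shows "(\<Sum>r\<in>{t<..T}. a r) = a (Suc t) + (\<Sum>r\<in>{Suc t<..T}. a r)"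
proof -
  have "{t<..T} = insert (Suc t) {Suc t<..T}"
    using assms by auto
  then show ?thesis
    by (simp only: sum.insert finite_greaterThanAtMost greaterThanAtMost_iff less_irrefl simp_thms)
qed

lemma cost_to_go_eq:
  "t < T \<Longrightarrow> cost_to_go T X f P t x = (SUP p\<in>P (Suc t). \<integral>\<^sup>+\<xi>. stage_value T X f P (Suc t) x \<xi> \<partial>p)"
  unfolding stage_value_def by (subst cost_to_go.simps) simp

lemma nominal_cost_to_go_eq:
  "t < T \<Longrightarrow> nominal_cost_to_go T X f n s t x =
    (\<Sum>k=1..n (Suc t). nominal_stage_value T X f n s (Suc t) x (s (Suc t) k)) / of_nat (n (Suc t))"
  by (subst nominal_cost_to_go.simps) (simp add: nominal_stage_value_def)

lemma eval_cost_to_go_eq: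
  "t < T \<Longrightarrow> eval_cost_to_go T f \<nu> pol t x =
    (\<integral>\<^sup>+\<xi>. f (Suc t) x (pol (Suc t) x \<xi>) \<xi>
        + eval_cost_to_go T f \<nu> pol (Suc t) (pol (Suc t) x \<xi>) \<partial>\<nu> (Suc t))"
  by (subst eval_cost_to_go.simps) simp

lemma stage_value_le_nominal:
  assumes "\<And>y. y \<in> X t \<Longrightarrow> cost_to_go T X f P t y \<le> nominal_cost_to_go T X f n s t y + c"
  shows "stage_value T X f P t x \<xi> \<le> nominal_stage_value T X f n s t x \<xi> + c"
proof -
  have "stage_value T X f P t x \<xi> \<le> (INF y\<in>X t. (f t x y \<xi> + nominal_cost_to_go T X f n s t y) + c)"
    unfolding stage_value_def using assms
    by (intro INF_mono) (auto intro!: bexI[rotated] add_left_mono simp: add.assoc)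
  also have "\<dots> = nominal_stage_value T X f n s t x \<xi> + c"
    unfolding nominal_stage_value_def by (rule INF_add_const_ennreal)
  finally show ?thesis .
qed

text \<open>
  An empty state space at some stage costs \<open>\<infinity>\<close>, and the infinite cost propagates backwards to the
  first stage. This degenerate case has to be separated because a Lipschitz hypothesis over an empty
  set of states says nothing about the sign of the Lipschitz constant.
\<close>
lemma nominal_value_infinite_if_empty_stage:
  assumes n: "\<And>t. t \<in> {2..T} \<Longrightarrow> 1 \<le> n t" and t: "t \<in> {1..T}" "X t = {}"
  shows "nominal_stage_value T X f n s 1 x \<xi> = top"
proof -
  have "nominal_stage_value T X f n s r x \<xi> = top" if "r \<le> t" "1 \<le> r" for r x \<xi>
    using that
  proof (induction r arbitrary: x \<xi> rule: inc_induct)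
    case base
    then show ?case using t by (simp add: nominal_stage_value_def)
  next
    case (step r)
    have "1 \<le> n (Suc r)"
      using step t by (intro n) auto
    then have "nominal_cost_to_go T X f n s r y = top" for y
      using step t
      by (subst nominal_cost_to_go_eq) (auto simp: ennreal_top_divide ennreal_mult_top)
    then show ?case
      by (simp add: nominal_stage_value_def)
  qed
  then show ?thesis using t by simp
qed

context dr_mco
begin

lemma stage_metric: "t \<in> {1..T} \<Longrightarrow> measurable_metric (\<Xi> t) (d t)"
  by (intro measurable_metric.intro measurable_metric_axioms.intro dist_metric dist_measurable)

text \<open>
  Backward induction. Every member of the ambiguity set is within \<open>\<rho> t 0\<close> of the empirical measure,
  so replacing the worst-case expectation by the sample average costs at most \<open>l t * \<rho> t 0\<close> at each
  stage; the errors of the later stages are constants, which pass through infima and averages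
  unchanged.
\<close>
lemma cost_to_go_le_nominal:
  fixes n :: "nat \<Rightarrow> nat" and \<rho> :: "nat \<Rightarrow> nat \<Rightarrow> real" and s :: "nat \<Rightarrow> nat \<Rightarrow> 'b"
  defines "P \<equiv> dr_ambiguity \<Xi> d n m g \<rho> s"
  assumes n: "\<And>t. t \<in> {2..T} \<Longrightarrow> 1 \<le> n t"
    and s: "\<And>t k. t \<in> {2..T} \<Longrightarrow> k \<in> {1..n t} \<Longrightarrow> s t k \<in> \<Xi> t"
    and \<rho>: "\<And>t. t \<in> {2..T} \<Longrightarrow> 0 < \<rho> t 0"
    and lip: "lipschitz_in_uncertainty T X \<Xi> d l (stage_value T X f P)"
    and "1 \<le> t" "t \<le> T" "x \<in> X t"
  shows "cost_to_go T X f P t x \<le> nominal_cost_to_go T X f n s t x + (\<Sum>r\<in>{t<..T}. ennreal (l r * \<rho> r 0))"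
  using \<open>t \<le> T\<close> \<open>1 \<le> t\<close> \<open>x \<in> X t\<close>
proof (induction t arbitrary: x rule: inc_induct)
  case base
  show ?case by (simp add: cost_to_go.simps)
next
  case (step t)
  define c where "c = (\<Sum>r\<in>{Suc t<..T}. ennreal (l r * \<rho> r 0))"
  have mem: "Suc t \<in> {1..T}" "Suc t \<in> {2..T}"
    using step by auto
  interpret measurable_metric "\<Xi> (Suc t)" "d (Suc t)"
    by (rule stage_metric) fact
  have lipQ: "ennreal_lipschitz_on (\<Xi> (Suc t)) (d (Suc t)) (l (Suc t)) (stage_value T X f P (Suc t) x)"
    using lip mem(1) step.prems unfolding lipschitz_in_uncertainty_def by (metis diff_Suc_1)
  have "cost_to_go T X f P t x
      \<le> (\<Sum>k=1..n (Suc t). stage_value T X f P (Suc t) x (s (Suc t) k)) / of_nat (n (Suc t))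
        + ennreal (l (Suc t) * \<rho> (Suc t) 0)"
    unfolding cost_to_go_eq[OF \<open>t < T\<close>]
  proof (intro SUP_least sample_average_lipschitz_bound(1))
    fix p assume p: "p \<in> P (Suc t)"
    show "wasserstein (d (Suc t)) p (empirical (\<Xi> (Suc t)) (n (Suc t)) (s (Suc t))) \<le> ennreal (\<rho> (Suc t) 0)"
      "sets p = sets (restrict_space borel (\<Xi> (Suc t)))"
      using p by (auto simp: P_def dr_ambiguity_def ambiguity_set_def wasserstein_space_def)
  qed (use n s \<rho> mem lipQ in \<open>auto intro: less_imp_le\<close>)
  also have "\<dots> \<le> (\<Sum>k=1..n (Suc t). nominal_stage_value T X f n s (Suc t) x (s (Suc t) k) + c) / of_nat (n (Suc t))
        + ennreal (l (Suc t) * \<rho> (Suc t) 0)"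
    unfolding c_def using step.IH
    by (intro add_right_mono divide_right_mono_ennreal sum_mono stage_value_le_nominal) auto
  also have "\<dots> = nominal_cost_to_go T X f n s t x + (ennreal (l (Suc t) * \<rho> (Suc t) 0) + c)"
    unfolding average_add_const[OF n[OF mem(2)]] nominal_cost_to_go_eq[OF \<open>t < T\<close>] by (simp only: ac_simps)
  also have "ennreal (l (Suc t) * \<rho> (Suc t) 0) + c = (\<Sum>r\<in>{t<..T}. ennreal (l r * \<rho> r 0))"
    unfolding c_def using \<open>t < T\<close> by (rule sum_greaterThanAtMost_head[symmetric])
  finally show ?case .
qed

text \<open>
  The same induction in the other direction, with \<open>\<nu> t\<close> in place of the worst-case measure. The
  nominal value is an infimum over feasible decisions, hence at most the cost of any policy that
  stays in the state spaces.
\<close>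
lemma nominal_cost_to_go_le_eval:
  fixes n :: "nat \<Rightarrow> nat" and \<rho> :: "nat \<Rightarrow> nat \<Rightarrow> real" and s :: "nat \<Rightarrow> nat \<Rightarrow> 'b"
  assumes n: "\<And>t. t \<in> {2..T} \<Longrightarrow> 1 \<le> n t"
    and s: "\<And>t k. t \<in> {2..T} \<Longrightarrow> k \<in> {1..n t} \<Longrightarrow> s t k \<in> \<Xi> t"
    and \<rho>: "\<And>t. t \<in> {2..T} \<Longrightarrow> 0 < \<rho> t 0"
    and \<nu>: "\<And>t. t \<in> {2..T} \<Longrightarrow> \<nu> t \<in> wasserstein_space (\<Xi> t) (d t)"
    and close: "\<And>t. t \<in> {2..T} \<Longrightarrow> wasserstein (d t) (\<nu> t) (empirical (\<Xi> t) (n t) (s t)) \<le> ennreal (\<rho> t 0)"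
    and lip: "lipschitz_in_uncertainty T X \<Xi> d l (nominal_stage_value T X f n s)"
    and pol: "\<And>t x \<xi>. t \<in> {2..T} \<Longrightarrow> x \<in> X (t - 1) \<Longrightarrow> \<xi> \<in> \<Xi> t \<Longrightarrow> pol t x \<xi> \<in> X t"
    and "1 \<le> t" "t \<le> T" "x \<in> X t"
  shows "nominal_cost_to_go T X f n s t x \<le> eval_cost_to_go T f \<nu> pol t x + (\<Sum>r\<in>{t<..T}. ennreal (l r * \<rho> r 0))"
  using \<open>t \<le> T\<close> \<open>1 \<le> t\<close> \<open>x \<in> X t\<close>
proof (induction t arbitrary: x rule: inc_induct)
  case base
  show ?case by (simp add: nominal_cost_to_go.simps)
next
  case (step t)
  define c where "c = (\<Sum>r\<in>{Suc t<..T}. ennreal (l r * \<rho> r 0))"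
  define h where "h \<xi> = f (Suc t) x (pol (Suc t) x \<xi>) \<xi> + eval_cost_to_go T f \<nu> pol (Suc t) (pol (Suc t) x \<xi>)" for \<xi>
  have mem: "Suc t \<in> {1..T}" "Suc t \<in> {2..T}"
    using step by auto
  interpret measurable_metric "\<Xi> (Suc t)" "d (Suc t)"
    by (rule stage_metric) fact
  have lipQ: "ennreal_lipschitz_on (\<Xi> (Suc t)) (d (Suc t)) (l (Suc t)) (nominal_stage_value T X f n s (Suc t) x)"
    using lip mem(1) step.prems unfolding lipschitz_in_uncertainty_def by (metis diff_Suc_1)
  have prob: "prob_space (\<nu> (Suc t))" and sets: "sets (\<nu> (Suc t)) = sets (restrict_space borel (\<Xi> (Suc t)))"
    using \<nu>[OF mem(2)] by (auto simp: wasserstein_space_def)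
  have space: "space (\<nu> (Suc t)) = \<Xi> (Suc t)"
    using sets_eq_imp_space_eq[OF sets] by (simp add: space_restrict_space)
  have policy_cost: "nominal_stage_value T X f n s (Suc t) x \<xi> \<le> h \<xi> + c" if "\<xi> \<in> \<Xi> (Suc t)" for \<xi>
  proof -
    have y: "pol (Suc t) x \<xi> \<in> X (Suc t)"
      using pol[OF mem(2)] step.prems that by simp
    have "nominal_stage_value T X f n s (Suc t) x \<xi>
        \<le> f (Suc t) x (pol (Suc t) x \<xi>) \<xi> + nominal_cost_to_go T X f n s (Suc t) (pol (Suc t) x \<xi>)"
      unfolding nominal_stage_value_def using y by (rule INF_lower)
    also have "\<dots> \<le> h \<xi> + c"
      unfolding h_def c_def add.assoc using step.IH[OF _ y] by (intro add_left_mono) simp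
    finally show ?thesis .
  qed
  have "nominal_cost_to_go T X f n s t x
      \<le> (\<integral>\<^sup>+\<xi>. nominal_stage_value T X f n s (Suc t) x \<xi> \<partial>\<nu> (Suc t)) + ennreal (l (Suc t) * \<rho> (Suc t) 0)"
    unfolding nominal_cost_to_go_eq[OF \<open>t < T\<close>]
    by (rule sample_average_lipschitz_bound(2)[OF close[OF mem(2)]])
      (use n s \<rho> mem lipQ sets in \<open>auto intro: less_imp_le\<close>)
  also have "\<dots> \<le> (\<integral>\<^sup>+\<xi>. h \<xi> + c \<partial>\<nu> (Suc t)) + ennreal (l (Suc t) * \<rho> (Suc t) 0)"
    using policy_cost by (intro add_right_mono nn_integral_mono) (simp add: space)
  also have "\<dots> \<le> (\<integral>\<^sup>+\<xi>. h \<xi> \<partial>\<nu> (Suc t)) + c + ennreal (l (Suc t) * \<rho> (Suc t) 0)"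
    by (intro add_right_mono nn_integral_add_const_le prob)
  also have "\<dots> = eval_cost_to_go T f \<nu> pol t x + (ennreal (l (Suc t) * \<rho> (Suc t) 0) + c)"
    unfolding h_def eval_cost_to_go_eq[OF \<open>t < T\<close>] by (simp only: ac_simps)
  also have "ennreal (l (Suc t) * \<rho> (Suc t) 0) + c = (\<Sum>r\<in>{t<..T}. ennreal (l r * \<rho> r 0))"
    unfolding c_def using \<open>t < T\<close> by (rule sum_greaterThanAtMost_head[symmetric])
  finally show ?case .
qed

text \<open>
  Converting between the sum of extended nonnegative summands and the real sum requires each
  summand to be nonnegative; nonempty state spaces make the Lipschitz constants so.
\<close>
lemma sum_radius_bounds:
  assumes lip: "lipschitz_in_uncertainty T X \<Xi> d l Q"
    and nonempty: "\<And>t. t \<in> {1..T} \<Longrightarrow> X t \<noteq> {}"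
    and \<rho>: "\<And>t. t \<in> {2..T} \<Longrightarrow> 0 < \<rho> t 0"
  shows "(\<Sum>r\<in>{1<..T}. ennreal (l r * \<rho> r 0)) = ennreal (\<Sum>t=2..T. l t * \<rho> t 0)"
    and "0 \<le> (\<Sum>t=2..T. l t * \<rho> t 0)"
proof -
  have nonneg: "0 \<le> l t * \<rho> t 0" if t: "t \<in> {2..T}" for t
  proof -
    obtain x where "x \<in> X (t - 1)"
      using nonempty[of "t - 1"] t by force
    then have "0 \<le> l t"
      using lip t by (auto simp: lipschitz_in_uncertainty_def ennreal_lipschitz_on_def)
    then show ?thesis
      using \<rho>[OF t] by simp
  qed
  have "{1<..T} = {2..T}" by auto
  then show "(\<Sum>r\<in>{1<..T}. ennreal (l r * \<rho> r 0)) = ennreal (\<Sum>t=2..T. l t * \<rho> t 0)"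
    using sum_ennreal[of "{2..T}" "\<lambda>t. l t * \<rho> t 0"] nonneg by simp
  show "0 \<le> (\<Sum>t=2..T. l t * \<rho> t 0)"
    by (rule sum_nonneg) (rule nonneg)
qed

lemma stage_value_le_nominal_value:
  fixes n :: "nat \<Rightarrow> nat" and \<rho> :: "nat \<Rightarrow> nat \<Rightarrow> real" and s :: "nat \<Rightarrow> nat \<Rightarrow> 'b"
  defines "P \<equiv> dr_ambiguity \<Xi> d n m g \<rho> s"
  assumes n: "\<And>t. t \<in> {2..T} \<Longrightarrow> 1 \<le> n t"
    and s: "\<And>t k. t \<in> {2..T} \<Longrightarrow> k \<in> {1..n t} \<Longrightarrow> s t k \<in> \<Xi> t"
    and \<rho>: "\<And>t. t \<in> {2..T} \<Longrightarrow> 0 < \<rho> t 0"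
    and lip: "lipschitz_in_uncertainty T X \<Xi> d l (stage_value T X f P)"
  shows "stage_value T X f P 1 x0 \<xi>1
    \<le> nominal_stage_value T X f n s 1 x0 \<xi>1 + ennreal (\<Sum>t=2..T. l t * \<rho> t 0)"
proof (cases "\<exists>t\<in>{1..T}. X t = {}")
  case True
  then obtain t where t: "t \<in> {1..T}" "X t = {}" by auto
  have "nominal_stage_value T X f n s 1 x0 \<xi>1 = top"
    using n t by (rule nominal_value_infinite_if_empty_stage)
  then show ?thesis by simp
next
  case False
  then have nonempty: "X t \<noteq> {}" if "t \<in> {1..T}" for t
    using that by auto
  have sum: "(\<Sum>r\<in>{1<..T}. ennreal (l r * \<rho> r 0)) = ennreal (\<Sum>t=2..T. l t * \<rho> t 0)"
    using lip nonempty \<rho> by (rule sum_radius_bounds(1))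
  have T: "1 \<le> T"
    using horizon by simp
  show ?thesis
    unfolding sum[symmetric]
  proof (rule stage_value_le_nominal)
    fix y assume y: "y \<in> X 1"
    show "cost_to_go T X f P 1 y
      \<le> nominal_cost_to_go T X f n s 1 y + (\<Sum>r\<in>{1<..T}. ennreal (l r * \<rho> r 0))"
      using n s \<rho> lip order_refl T y unfolding P_def by (rule cost_to_go_le_nominal)
  qed
qed

lemma nominal_value_le_eval_value:
  fixes n :: "nat \<Rightarrow> nat" and \<rho> :: "nat \<Rightarrow> nat \<Rightarrow> real" and s :: "nat \<Rightarrow> nat \<Rightarrow> 'b"
  assumes n: "\<And>t. t \<in> {2..T} \<Longrightarrow> 1 \<le> n t"
    and s: "\<And>t k. t \<in> {2..T} \<Longrightarrow> k \<in> {1..n t} \<Longrightarrow> s t k \<in> \<Xi> t"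
    and \<rho>: "\<And>t. t \<in> {2..T} \<Longrightarrow> 0 < \<rho> t 0"
    and \<nu>: "\<And>t. t \<in> {2..T} \<Longrightarrow> \<nu> t \<in> wasserstein_space (\<Xi> t) (d t)"
    and close: "\<And>t. t \<in> {2..T} \<Longrightarrow> wasserstein (d t) (\<nu> t) (empirical (\<Xi> t) (n t) (s t)) \<le> ennreal (\<rho> t 0)"
    and lip: "lipschitz_in_uncertainty T X \<Xi> d l (nominal_stage_value T X f n s)"
    and y1: "y1 \<in> X 1"
    and pol: "\<And>t x \<xi>. t \<in> {2..T} \<Longrightarrow> x \<in> X (t - 1) \<Longrightarrow> \<xi> \<in> \<Xi> t \<Longrightarrow> pol t x \<xi> \<in> X t"
  shows "nominal_stage_value T X f n s 1 x0 \<xi>1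
      \<le> eval_value T f \<nu> x0 \<xi>1 y1 pol + ennreal (\<Sum>t=2..T. l t * \<rho> t 0)"
    and "0 \<le> (\<Sum>t=2..T. l t * \<rho> t 0)"
proof -
  \<comment> \<open>Following the policy along the first samples visits every state space.\<close>
  have nonempty: "X t \<noteq> {}" if "1 \<le> t" "t \<le> T" for t
    using that
  proof (induction t rule: dec_induct)
    case base
    show ?case using y1 by auto
  next
    case (step t)
    then obtain x where "x \<in> X t" by auto
    moreover have "s (Suc t) 1 \<in> \<Xi> (Suc t)"
      using step n[of "Suc t"] by (intro s) auto
    ultimately have "pol (Suc t) x (s (Suc t) 1) \<in> X (Suc t)"
      using step by (intro pol) auto
    then show ?case by auto
  qed
  then have nonempty': "X t \<noteq> {}" if "t \<in> {1..T}" for t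
    using that by auto
  have sum: "(\<Sum>r\<in>{1<..T}. ennreal (l r * \<rho> r 0)) = ennreal (\<Sum>t=2..T. l t * \<rho> t 0)"
    using lip nonempty' \<rho> by (rule sum_radius_bounds(1))
  show "0 \<le> (\<Sum>t=2..T. l t * \<rho> t 0)"
    using lip nonempty' \<rho> by (rule sum_radius_bounds(2))
  have T: "1 \<le> T"
    using horizon by simp
  have "nominal_stage_value T X f n s 1 x0 \<xi>1 \<le> f 1 x0 y1 \<xi>1 + nominal_cost_to_go T X f n s 1 y1"
    unfolding nominal_stage_value_def using y1 by (rule INF_lower)
  also have "\<dots> \<le> eval_value T f \<nu> x0 \<xi>1 y1 pol + ennreal (\<Sum>t=2..T. l t * \<rho> t 0)"
    unfolding eval_value_def sum[symmetric] add.assoc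
    by (rule add_left_mono) (use n s \<rho> \<nu> close lip pol order_refl T y1 in \<open>rule nominal_cost_to_go_le_eval\<close>)
  finally show "nominal_stage_value T X f n s 1 x0 \<xi>1
      \<le> eval_value T f \<nu> x0 \<xi>1 y1 pol + ennreal (\<Sum>t=2..T. l t * \<rho> t 0)" .
qed

end

section \<open>Probability that all empirical measures are close\<close>

lemma empirical_cong:
  assumes "\<And>k. k \<in> {1..n} \<Longrightarrow> s k = s' k"
  shows "empirical S n s = empirical S n s'"
  unfolding empirical_def using assms by (intro distr_cong) (auto simp: space_uniform_count_measure)

text \<open>
  Each block \<open>(Y t k)\<close>, \<open>k \<in> K t\<close>, of a jointly independent family has a product law, and different
  blocks are independent, so the probability that no block falls into its exceptional set \<open>B t\<close>
  is a product over the blocks.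
\<close>
lemma (in prob_space) indep_vars_blocks_avoid:
  fixes Y :: "'i \<Rightarrow> 'k \<Rightarrow> 'a \<Rightarrow> 'c" and K :: "'i \<Rightarrow> 'k set"
  assumes indep: "indep_vars (\<lambda>(t, k). N t) (\<lambda>(t, k). Y t k) (SIGMA t:I. K t)"
    and I: "finite I" "I \<noteq> {}" and K: "\<And>t. t \<in> I \<Longrightarrow> K t \<noteq> {}"
    and law: "\<And>t k. t \<in> I \<Longrightarrow> k \<in> K t \<Longrightarrow> distr M (N t) (Y t k) = \<nu> t"
    and B: "\<And>t. t \<in> I \<Longrightarrow> B t \<in> sets (PiM (K t) (\<lambda>_. \<nu> t))"
  shows "{\<omega> \<in> space M. \<forall>t\<in>I. (\<lambda>k\<in>K t. Y t k \<omega>) \<in> space (PiM (K t) (\<lambda>_. \<nu> t)) - B t} \<in> events"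
    and "prob {\<omega> \<in> space M. \<forall>t\<in>I. (\<lambda>k\<in>K t. Y t k \<omega>) \<in> space (PiM (K t) (\<lambda>_. \<nu> t)) - B t}
      = (\<Prod>t\<in>I. 1 - measure (PiM (K t) (\<lambda>_. \<nu> t)) (B t))"
proof -
  define N' where "N' = (\<lambda>(t, k :: 'k). N t)"
  define Y' where "Y' = (\<lambda>(t, k). Y t k)"
  define Z where "Z t \<omega> = (\<lambda>k\<in>K t. Y t k \<omega>)" for t \<omega>
  define G where "G t = space (PiM (K t) (\<lambda>_. \<nu> t)) - B t" for t
  have indep': "indep_vars N' Y' (SIGMA t:I. K t)"
    using indep by (simp add: N'_def Y'_def)
  have rv: "Y t k \<in> M \<rightarrow>\<^sub>M N t" if "t \<in> I" "k \<in> K t" for t k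
    using indep that by (auto simp: indep_vars_def)
  have sets_\<nu>: "sets (\<nu> t) = sets (N t)" if "t \<in> I" for t
    using K[OF that] law[OF that] by (metis all_not_in_conv sets_distr)
  have sets_P: "sets (PiM (K t) (\<lambda>_. \<nu> t)) = sets (PiM (K t) (\<lambda>_. N t))" if "t \<in> I" for t
    using sets_\<nu>[OF that] by (intro sets_PiM_cong) auto
  have indep_Z: "indep_vars (\<lambda>t. PiM (K t) (\<lambda>_. N t)) Z I"
  proof -
    have "indep_vars (\<lambda>t. PiM ({t} \<times> K t) N') (\<lambda>t \<omega>. restrict (\<lambda>i. Y' i \<omega>) ({t} \<times> K t)) I"
      by (intro indep_vars_restrict[OF indep']) (auto simp: disjoint_family_on_def)
    then have "indep_vars (\<lambda>t. PiM (K t) (\<lambda>_. N t))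
        (\<lambda>t \<omega>. (\<lambda>k\<in>K t. restrict (\<lambda>i. Y' i \<omega>) ({t} \<times> K t) (t, k))) I"
    proof (rule indep_vars_compose2)
      fix t
      show "(\<lambda>h. \<lambda>k\<in>K t. h (t, k)) \<in> PiM ({t} \<times> K t) N' \<rightarrow>\<^sub>M PiM (K t) (\<lambda>_. N t)"
      proof (rule measurable_restrict)
        fix k assume "k \<in> K t"
        then have "(\<lambda>h. h (t, k)) \<in> PiM ({t} \<times> K t) N' \<rightarrow>\<^sub>M N' (t, k)"
          by (intro measurable_component_singleton) auto
        then show "(\<lambda>h. h (t, k)) \<in> PiM ({t} \<times> K t) N' \<rightarrow>\<^sub>M N t"
          by (simp add: N'_def)
      qed
    qed
    moreover have "(\<lambda>t \<omega>. (\<lambda>k\<in>K t. restrict (\<lambda>i. Y' i \<omega>) ({t} \<times> K t) (t, k))) = Z"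
      by (auto simp: fun_eq_iff Z_def Y'_def restrict_def)
    ultimately show ?thesis by simp
  qed
  have law_Z: "distr M (PiM (K t) (\<lambda>_. N t)) (Z t) = PiM (K t) (\<lambda>_. \<nu> t)" if t: "t \<in> I" for t
  proof -
    \<comment> \<open>Independence within a block, by grouping the family into singletons indexed by \<open>k\<close>.\<close>
    have "indep_vars (\<lambda>k. PiM {(t, k)} N') (\<lambda>k \<omega>. restrict (\<lambda>i. Y' i \<omega>) {(t, k)}) (K t)"
      using t by (intro indep_vars_restrict[OF indep']) (auto simp: disjoint_family_on_def)
    then have "indep_vars (\<lambda>_. N t) (\<lambda>k \<omega>. restrict (\<lambda>i. Y' i \<omega>) {(t, k)} (t, k)) (K t)"
    proof (rule indep_vars_compose2)
      fix k
      have "(\<lambda>h. h (t, k)) \<in> PiM {(t, k)} N' \<rightarrow>\<^sub>M N' (t, k)"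
        by (intro measurable_component_singleton) auto
      then show "(\<lambda>h. h (t, k)) \<in> PiM {(t, k)} N' \<rightarrow>\<^sub>M N t"
        by (simp add: N'_def)
    qed
    then have "indep_vars (\<lambda>_. N t) (Y t) (K t)"
      by (simp add: Y'_def)
    then have "distr M (PiM (K t) (\<lambda>_. N t)) (Z t) = PiM (K t) (\<lambda>k. distr M (N t) (Y t k))"
      unfolding Z_def using indep_vars_iff_distr_eq_PiM'[OF K[OF t], of "Y t" "\<lambda>_. N t"] rv[OF t] by blast
    also have "\<dots> = PiM (K t) (\<lambda>_. \<nu> t)"
      using law[OF t] by (intro PiM_cong) auto
    finally show ?thesis .
  qed
  have Z: "Z t \<in> M \<rightarrow>\<^sub>M PiM (K t) (\<lambda>_. N t)" if "t \<in> I" for t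
    using indep_Z that by (auto simp: indep_vars_def)
  have G: "G t \<in> sets (PiM (K t) (\<lambda>_. N t))" if "t \<in> I" for t
    using B[OF that] sets.compl_sets[of "B t" "PiM (K t) (\<lambda>_. \<nu> t)"] sets_P[OF that]
    unfolding G_def by blast
  have eq: "{\<omega> \<in> space M. \<forall>t\<in>I. (\<lambda>k\<in>K t. Y t k \<omega>) \<in> space (PiM (K t) (\<lambda>_. \<nu> t)) - B t}
      = (\<Inter>t\<in>I. Z t -` G t \<inter> space M)"
    using I(2) by (auto simp: Z_def G_def)
  show "{\<omega> \<in> space M. \<forall>t\<in>I. (\<lambda>k\<in>K t. Y t k \<omega>) \<in> space (PiM (K t) (\<lambda>_. \<nu> t)) - B t} \<in> events"
    unfolding eq using I Z G by (intro sets.finite_INT measurable_sets) auto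
  have "prob (\<Inter>t\<in>I. Z t -` G t \<inter> space M) = (\<Prod>t\<in>I. prob (Z t -` G t \<inter> space M))"
    using indep_Z I(2,1) G by (rule indep_varsD_finite)
  also have "\<dots> = (\<Prod>t\<in>I. 1 - measure (PiM (K t) (\<lambda>_. \<nu> t)) (B t))"
  proof (rule prod.cong)
    fix t assume t: "t \<in> I"
    have "prob_space (PiM (K t) (\<lambda>_. \<nu> t))"
      unfolding law_Z[OF t, symmetric] using Z[OF t] by (rule prob_space_distr)
    then have "measure (PiM (K t) (\<lambda>_. \<nu> t)) (G t) = 1 - measure (PiM (K t) (\<lambda>_. \<nu> t)) (B t)"
      unfolding G_def using B[OF t] by (rule prob_space.prob_compl)
    moreover have "measure (PiM (K t) (\<lambda>_. \<nu> t)) (G t) = prob (Z t -` G t \<inter> space M)"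
      unfolding law_Z[OF t, symmetric] using Z[OF t] G[OF t] by (rule measure_distr)
    ultimately show "prob (Z t -` G t \<inter> space M) = 1 - measure (PiM (K t) (\<lambda>_. \<nu> t)) (B t)"
      by simp
  qed simp
  finally show "prob {\<omega> \<in> space M. \<forall>t\<in>I. (\<lambda>k\<in>K t. Y t k \<omega>) \<in> space (PiM (K t) (\<lambda>_. \<nu> t)) - B t}
      = (\<Prod>t\<in>I. 1 - measure (PiM (K t) (\<lambda>_. \<nu> t)) (B t))"
    unfolding eq .
qed

lemma exp_tail_le:
  fixes c C x \<gamma> :: real
  assumes "0 < C" "0 < c" "0 < \<gamma>" "1 / c * (ln C - ln \<gamma>) \<le> x"
  shows "C * exp (- (c * x)) \<le> \<gamma>"
proof -
  have "ln C - ln \<gamma> \<le> c * x"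
    using assms by (simp add: field_simps)
  then have "exp (ln C + - (c * x)) \<le> exp (ln \<gamma>)"
    by simp
  then show ?thesis
    using assms by (simp only: exp_add exp_ln)
qed

text \<open>
  The sample size condition is the concentration bound solved for \<open>n\<close>. The
  bound involves \<open>n * r ^ \<delta>\<close> for \<open>r \<le> 1\<close> and \<open>n * r\<^sup>2\<close> otherwise or in addition; the minimum in the
  condition is below both. Under third moments the two terms of the bound receive \<open>\<gamma> / 2\<close> each, which is
  the source of the factors \<open>2\<close>.
\<close>
lemma deviation_prob_le:
  assumes cc: "concentration_constants V \<delta> S d \<nu> C C' C''"
    and n: "1 \<le> n" and r: "0 < r" and \<gamma>: "0 < \<gamma>"
    and sample_size:
      "(sub_gaussian V \<nu> \<and> 3 \<le> \<delta> \<and> real n * min (r ^ \<delta>) (r\<^sup>2) \<ge> 1 / C' * (ln C - ln \<gamma>)) \<or>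
       (finite_third_moments \<nu> \<and> 2 \<le> \<delta> \<and>
        real n * min (r ^ \<delta>) (r\<^sup>2) \<ge> max (1 / C' * (ln (2 * C) - ln \<gamma>)) (2 * C'' / \<gamma>))"
  shows "deviation_prob S d \<nu> n r \<le> ennreal \<gamma>"
proof -
  have pos: "0 < C" "0 < C'" "0 < C''"
    using cc by (auto simp: concentration_constants_def)
  have nmin: "real n * min (r ^ \<delta>) (r\<^sup>2) \<le> real n * r ^ \<delta>" "real n * min (r ^ \<delta>) (r\<^sup>2) \<le> real n * r\<^sup>2"
    by (intro mult_left_mono; simp)+
  from sample_size show ?thesis
  proof (elim disjE conjE)
    assume "sub_gaussian V \<nu>" "3 \<le> \<delta>"
      and size: "real n * min (r ^ \<delta>) (r\<^sup>2) \<ge> 1 / C' * (ln C - ln \<gamma>)"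
    then have "deviation_prob S d \<nu> n r \<le> ennreal
        (C * exp (- C' * real n * r ^ \<delta>) * of_bool (r \<le> 1) + C * exp (- C' * real n * r\<^sup>2) * of_bool (r > 1))"
      using cc n r unfolding concentration_constants_def by blast
    also have "\<dots> \<le> ennreal \<gamma>"
      using exp_tail_le[OF pos(1,2) \<gamma> order_trans[OF size nmin(1)]]
        exp_tail_le[OF pos(1,2) \<gamma> order_trans[OF size nmin(2)]]
      by (intro ennreal_leI) (auto simp: of_bool_def mult.assoc)
    finally show ?thesis .
  next
    assume "finite_third_moments \<nu>"
      and size: "real n * min (r ^ \<delta>) (r\<^sup>2) \<ge> max (1 / C' * (ln (2 * C) - ln \<gamma>)) (2 * C'' / \<gamma>)"
    then have "deviation_prob S d \<nu> n r \<le> ennreal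
        (C * exp (- C' * real n * r ^ \<delta>) * of_bool (r \<le> 1) + C'' / (real n * r\<^sup>2))"
      using cc n r unfolding concentration_constants_def by blast
    also have "\<dots> \<le> ennreal \<gamma>"
    proof (rule ennreal_leI)
      have "1 / C' * (ln (2 * C) - ln \<gamma>) \<le> real n * r ^ \<delta>"
        using size nmin(1) by linarith
      then have "2 * C * exp (- (C' * (real n * r ^ \<delta>))) \<le> \<gamma>"
        using pos \<gamma> by (intro exp_tail_le) auto
      then have "C * exp (- C' * real n * r ^ \<delta>) \<le> \<gamma> / 2"
        by (simp add: mult.assoc)
      moreover have "C'' / (real n * r\<^sup>2) \<le> \<gamma> / 2"
      proof -
        have "2 * C'' / \<gamma> \<le> real n * r\<^sup>2"
          using size nmin(2) by linarith
        then show ?thesis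
          using \<gamma> n r by (simp add: field_simps)
      qed
      moreover have "a * of_bool b + c \<le> \<gamma>" if "a \<le> \<gamma> / 2" "c \<le> \<gamma> / 2" for a c :: real and b
        using that \<gamma> by (cases b) auto
      ultimately show "C * exp (- C' * real n * r ^ \<delta>) * of_bool (r \<le> 1) + C'' / (real n * r\<^sup>2) \<le> \<gamma>"
        by blast
    qed
    finally show ?thesis .
  qed
qed

context dr_mco
begin

text \<open>
  The \<open>T - 1\<close> stages are independent and each is good with probability at least
  \<open>\<alpha>\<close> to the power \<open>1 / (T - 1)\<close>, so all are good with probability at least \<open>\<alpha>\<close>. The deviation
  events need not be measurable; they are replaced by measurable supersets \<open>B t\<close> of the same outer
  measure.
\<close>
lemma prob_all_stages_close:
  fixes M :: "'w measure" and n :: "nat \<Rightarrow> nat" and \<xi>hat :: "nat \<Rightarrow> nat \<Rightarrow> 'w \<Rightarrow> 'b"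
    and r :: "nat \<Rightarrow> real"
  assumes M: "prob_space M"
    and n: "\<And>t. t \<in> {2..T} \<Longrightarrow> 1 \<le> n t"
    and indep: "prob_space.indep_vars M (\<lambda>(t, k). restrict_space borel (\<Xi> t)) (\<lambda>(t, k). \<xi>hat t k)
          (SIGMA t:{2..T}. {1..n t})"
    and law: "\<And>t k. t \<in> {2..T} \<Longrightarrow> k \<in> {1..n t} \<Longrightarrow> distr M (restrict_space borel (\<Xi> t)) (\<xi>hat t k) = \<nu> t"
    and dev: "\<And>t. t \<in> {2..T} \<Longrightarrow>
      deviation_prob (\<Xi> t) (d t) (\<nu> t) (n t) (r t) \<le> ennreal (1 - \<alpha> powr (1 / (real T - 1)))"
    and \<alpha>: "0 < \<alpha>" "\<alpha> < 1"
  obtains A where "A \<in> sets M" "\<alpha> \<le> measure M A"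
    "\<And>\<omega> t. \<omega> \<in> A \<Longrightarrow> t \<in> {2..T} \<Longrightarrow>
      wasserstein (d t) (\<nu> t) (empirical (\<Xi> t) (n t) (\<lambda>k. \<xi>hat t k \<omega>)) \<le> ennreal (r t)"
proof -
  interpret prob_space M by fact
  define \<beta> where "\<beta> = \<alpha> powr (1 / (real T - 1))"
  have \<beta>: "0 < \<beta>" "\<beta> \<le> 1"
    using \<alpha> horizon by (auto simp: \<beta>_def powr_le1)
  define N where "N t = PiM {1..n t} (\<lambda>_. \<nu> t)" for t
  define E where "E t = {s \<in> space (N t). wasserstein (d t) (\<nu> t) (empirical (\<Xi> t) (n t) s) > ennreal (r t)}" for t
  have "\<exists>B\<in>sets (N t). E t \<subseteq> B \<and> outer_measure_of (N t) (E t) = emeasure (N t) B" for t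
    by (rule outer_measure_of_attain) (auto simp: E_def)
  then obtain B where B: "\<And>t. B t \<in> sets (N t)" "\<And>t. E t \<subseteq> B t"
      "\<And>t. outer_measure_of (N t) (E t) = emeasure (N t) (B t)"
    by metis
  define A where "A = {\<omega> \<in> space M. \<forall>t\<in>{2..T}. (\<lambda>k\<in>{1..n t}. \<xi>hat t k \<omega>) \<in> space (N t) - B t}"
  have nonempty: "{1..n t} \<noteq> {}" if "t \<in> {2..T}" for t
    using n[OF that] by auto
  have T: "{2..T} \<noteq> {}"
    using horizon by auto
  note blocks = indep_vars_blocks_avoid[OF indep finite_atLeastAtMost T nonempty law B(1)[unfolded N_def],
      folded N_def, folded A_def]
  have small: "measure (N t) (B t) \<le> 1 - \<beta>" if t: "t \<in> {2..T}" for t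
  proof -
    have "emeasure (N t) (B t) \<le> ennreal (1 - \<beta>)"
      using dev[OF t] B(3)[of t] by (simp add: deviation_prob_def Let_def N_def E_def \<beta>_def)
    then show ?thesis
      using \<beta> by (simp add: measure_def enn2real_leI)
  qed
  have "\<alpha> = \<beta> ^ (T - 1)"
    using \<alpha> horizon by (simp add: \<beta>_def powr_realpow[symmetric] powr_powr of_nat_diff)
  also have "\<dots> = (\<Prod>t\<in>{2..T}. \<beta>)"
    by simp
  also have "\<dots> \<le> (\<Prod>t\<in>{2..T}. 1 - measure (N t) (B t))"
    using small \<beta> by (intro prod_mono) (auto simp: algebra_simps)
  also have "\<dots> = prob A"
    using blocks(2) by simp
  finally have "\<alpha> \<le> prob A" .
  moreover have "wasserstein (d t) (\<nu> t) (empirical (\<Xi> t) (n t) (\<lambda>k. \<xi>hat t k \<omega>)) \<le> ennreal (r t)"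
    if "\<omega> \<in> A" "t \<in> {2..T}" for \<omega> t
  proof -
    have "(\<lambda>k\<in>{1..n t}. \<xi>hat t k \<omega>) \<in> space (N t) - E t"
      using that B(2)[of t] by (auto simp: A_def)
    then have "wasserstein (d t) (\<nu> t) (empirical (\<Xi> t) (n t) (\<lambda>k\<in>{1..n t}. \<xi>hat t k \<omega>)) \<le> ennreal (r t)"
      by (auto simp: E_def not_less)
    also have "empirical (\<Xi> t) (n t) (\<lambda>k\<in>{1..n t}. \<xi>hat t k \<omega>) = empirical (\<Xi> t) (n t) (\<lambda>k. \<xi>hat t k \<omega>)"
      by (rule empirical_cong) simp
    finally show ?thesis .
  qed
  ultimately show ?thesis
    using that blocks(1) by blast
qed

end

section \<open>The optimality gap and the out-of-sample guarantee\<close>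

theorem theorem5:
  fixes T :: nat
    and X :: "nat \<Rightarrow> 'a::euclidean_space set"
    and x0 :: 'a
    and \<Xi> :: "nat \<Rightarrow> 'b::euclidean_space set"
    and \<xi>1 :: 'b
    and V :: "nat \<Rightarrow> 'b set"
    and \<delta> :: "nat \<Rightarrow> nat"
    and f :: "nat \<Rightarrow> 'a \<Rightarrow> 'a \<Rightarrow> 'b \<Rightarrow> ennreal"
    and d :: "nat \<Rightarrow> 'b \<Rightarrow> 'b \<Rightarrow> real"
    and m n :: "nat \<Rightarrow> nat"
    and g :: "nat \<Rightarrow> nat \<Rightarrow> 'b \<Rightarrow> real"
    and \<rho> :: "nat \<Rightarrow> nat \<Rightarrow> real"
    and l :: "nat \<Rightarrow> real"
  defines "P \<equiv> dr_ambiguity \<Xi> d n m g \<rho>"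
  assumes "dr_mco T X x0 \<Xi> \<xi>1 V \<delta> f d m g"
    and "\<forall>t\<in>{2..T}. 1 \<le> n t"
  shows
    "(\<forall>s :: nat \<Rightarrow> nat \<Rightarrow> 'b.
        (\<forall>t\<in>{2..T}. \<forall>k\<in>{1..n t}. s t k \<in> \<Xi> t) \<and>
        lipschitz_in_uncertainty T X \<Xi> d l (stage_value T X f (P s)) \<and>
        strictly_feasible T \<Xi> n m g \<rho> s
        \<longrightarrow> stage_value T X f (P s) 1 x0 \<xi>1
              \<le> nominal_stage_value T X f n s 1 x0 \<xi>1 + ennreal (\<Sum>t=2..T. l t * \<rho> t 0))
     \<and>
     (\<forall>(M :: 'w measure) (\<nu> :: nat \<Rightarrow> 'b measure) (\<xi>hat :: nat \<Rightarrow> nat \<Rightarrow> 'w \<Rightarrow> 'b)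
        (C :: nat \<Rightarrow> real) (C' :: nat \<Rightarrow> real) (C'' :: nat \<Rightarrow> real) (\<alpha> :: real)
        (y1 :: 'w \<Rightarrow> 'a) (pol :: 'w \<Rightarrow> nat \<Rightarrow> 'a \<Rightarrow> 'b \<Rightarrow> 'a).
        prob_space M \<and>
        (\<forall>t\<in>{2..T}. \<nu> t \<in> wasserstein_space (\<Xi> t) (d t)) \<and>
        prob_space.indep_vars M (\<lambda>(t, k). restrict_space borel (\<Xi> t)) (\<lambda>(t, k). \<xi>hat t k)
          (SIGMA t:{2..T}. {1..n t}) \<and>
        (\<forall>t\<in>{2..T}. \<forall>k\<in>{1..n t}. distr M (restrict_space borel (\<Xi> t)) (\<xi>hat t k) = \<nu> t) \<and>
        (AE \<omega> in M. let s = (\<lambda>t k. \<xi>hat t k \<omega>) in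
           lipschitz_in_uncertainty T X \<Xi> d l (stage_value T X f (P s)) \<and>
           lipschitz_in_uncertainty T X \<Xi> d l (nominal_stage_value T X f n s) \<and>
           strictly_feasible T \<Xi> n m g \<rho> s \<and>
           optimal_policy T X \<Xi> f (P s) x0 \<xi>1 (y1 \<omega>) (pol \<omega>)) \<and>
        (\<forall>t\<in>{2..T}. concentration_constants (V t) (\<delta> t) (\<Xi> t) (d t) (\<nu> t) (C t) (C' t) (C'' t)) \<and>
        0 < \<alpha> \<and> \<alpha> < 1 \<and>
        (\<forall>t\<in>{2..T}.
           (sub_gaussian (V t) (\<nu> t) \<and> 3 \<le> \<delta> t \<and>
            real (n t) * min (\<rho> t 0 ^ \<delta> t) ((\<rho> t 0)\<^sup>2)
              \<ge> 1 / C' t * (ln (C t) - ln (1 - \<alpha> powr (1 / (real T - 1)))))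
           \<or>
           (finite_third_moments (\<nu> t) \<and> 2 \<le> \<delta> t \<and>
            real (n t) * min (\<rho> t 0 ^ \<delta> t) ((\<rho> t 0)\<^sup>2)
              \<ge> max (1 / C' t * (ln (2 * C t) - ln (1 - \<alpha> powr (1 / (real T - 1)))))
                    (2 * C'' t / (1 - \<alpha> powr (1 / (real T - 1))))))
        \<longrightarrow> (\<exists>A \<in> sets M. measure M A \<ge> \<alpha> \<and>
              (\<forall>\<omega>\<in>A. stage_value T X f (P (\<lambda>t k. \<xi>hat t k \<omega>)) 1 x0 \<xi>1
                 \<le> eval_value T f \<nu> x0 \<xi>1 (y1 \<omega>) (pol \<omega>) + ennreal (2 * (\<Sum>t=2..T. l t * \<rho> t 0)))))"
proof -
  interpret dr_mco T X x0 \<Xi> \<xi>1 V \<delta> f d m g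
    by fact
  have n: "1 \<le> n t" if "t \<in> {2..T}" for t
    using assms(3) that by blast
  have dr_le_nominal: "stage_value T X f (P s) 1 x0 \<xi>1
      \<le> nominal_stage_value T X f n s 1 x0 \<xi>1 + ennreal (\<Sum>t=2..T. l t * \<rho> t 0)"
    if s: "\<forall>t\<in>{2..T}. \<forall>k\<in>{1..n t}. s t k \<in> \<Xi> t"
      and lip: "lipschitz_in_uncertainty T X \<Xi> d l (stage_value T X f (P s))"
      and feasible: "strictly_feasible T \<Xi> n m g \<rho> s" for s
    unfolding P_def
  proof (rule stage_value_le_nominal_value)
    show "lipschitz_in_uncertainty T X \<Xi> d l (stage_value T X f (dr_ambiguity \<Xi> d n m g \<rho> s))"
      using lip unfolding P_def .
  qed (use n s feasible in \<open>auto simp: strictly_feasible_def\<close>)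
  show ?thesis
  proof (rule conjI, goal_cases)
    case 1
    show ?case using dr_le_nominal by blast
  next
    case 2
    show ?case
    proof (intro allI impI, elim conjE)
      fix M :: "'w measure" and \<nu> :: "nat \<Rightarrow> 'b measure" and \<xi>hat :: "nat \<Rightarrow> nat \<Rightarrow> 'w \<Rightarrow> 'b"
        and C C' C'' :: "nat \<Rightarrow> real" and \<alpha> :: real
        and y1 :: "'w \<Rightarrow> 'a" and pol :: "'w \<Rightarrow> nat \<Rightarrow> 'a \<Rightarrow> 'b \<Rightarrow> 'a"
      define \<gamma> where "\<gamma> = 1 - \<alpha> powr (1 / (real T - 1))"
      assume M: "prob_space M"
        and \<nu>: "\<forall>t\<in>{2..T}. \<nu> t \<in> wasserstein_space (\<Xi> t) (d t)"
        and indep: "prob_space.indep_vars M (\<lambda>(t, k). restrict_space borel (\<Xi> t)) (\<lambda>(t, k). \<xi>hat t k)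
          (SIGMA t:{2..T}. {1..n t})"
        and law: "\<forall>t\<in>{2..T}. \<forall>k\<in>{1..n t}. distr M (restrict_space borel (\<Xi> t)) (\<xi>hat t k) = \<nu> t"
        and ae: "AE \<omega> in M. let s = (\<lambda>t k. \<xi>hat t k \<omega>) in
           lipschitz_in_uncertainty T X \<Xi> d l (stage_value T X f (P s)) \<and>
           lipschitz_in_uncertainty T X \<Xi> d l (nominal_stage_value T X f n s) \<and>
           strictly_feasible T \<Xi> n m g \<rho> s \<and>
           optimal_policy T X \<Xi> f (P s) x0 \<xi>1 (y1 \<omega>) (pol \<omega>)"
        and cc: "\<forall>t\<in>{2..T}. concentration_constants (V t) (\<delta> t) (\<Xi> t) (d t) (\<nu> t) (C t) (C' t) (C'' t)"
        and \<alpha>: "0 < \<alpha>" "\<alpha> < 1"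
        and "\<forall>t\<in>{2..T}.
           (sub_gaussian (V t) (\<nu> t) \<and> 3 \<le> \<delta> t \<and>
            real (n t) * min (\<rho> t 0 ^ \<delta> t) ((\<rho> t 0)\<^sup>2)
              \<ge> 1 / C' t * (ln (C t) - ln (1 - \<alpha> powr (1 / (real T - 1)))))
           \<or>
           (finite_third_moments (\<nu> t) \<and> 2 \<le> \<delta> t \<and>
            real (n t) * min (\<rho> t 0 ^ \<delta> t) ((\<rho> t 0)\<^sup>2)
              \<ge> max (1 / C' t * (ln (2 * C t) - ln (1 - \<alpha> powr (1 / (real T - 1)))))
                    (2 * C'' t / (1 - \<alpha> powr (1 / (real T - 1)))))"
      note sample_size = this(9)[folded \<gamma>_def]
      interpret prob_space M by fact
      obtain N where N: "N \<in> null_sets M"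
        and good: "\<And>\<omega>. \<omega> \<in> space M - N \<Longrightarrow>
           lipschitz_in_uncertainty T X \<Xi> d l (stage_value T X f (P (\<lambda>t k. \<xi>hat t k \<omega>))) \<and>
           lipschitz_in_uncertainty T X \<Xi> d l (nominal_stage_value T X f n (\<lambda>t k. \<xi>hat t k \<omega>)) \<and>
           strictly_feasible T \<Xi> n m g \<rho> (\<lambda>t k. \<xi>hat t k \<omega>) \<and>
           optimal_policy T X \<Xi> f (P (\<lambda>t k. \<xi>hat t k \<omega>)) x0 \<xi>1 (y1 \<omega>) (pol \<omega>)"
        using AE_E3[OF ae] unfolding Let_def by metis
      \<comment> \<open>The radii are deterministic, so their positivity can be read off at a single outcome.\<close>
      have "space M - N \<noteq> {}"
      proof
        assume "space M - N = {}"
        then have "emeasure M (space M) \<le> emeasure M N"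
          using N by (intro emeasure_mono) auto
        then show False
          using N by (simp add: emeasure_space_1 null_setsD1)
      qed
      then have \<rho>: "0 < \<rho> t 0" if "t \<in> {2..T}" for t
        using good that unfolding strictly_feasible_def by blast
      have "1 / (real T - 1) > 0"
        using horizon by simp
      then have \<gamma>: "0 < \<gamma>"
        using powr_less_mono2[of "1 / (real T - 1)" \<alpha> 1] \<alpha> by (simp add: \<gamma>_def)
      have dev: "deviation_prob (\<Xi> t) (d t) (\<nu> t) (n t) (\<rho> t 0) \<le> ennreal \<gamma>" if t: "t \<in> {2..T}" for t
        using cc[rule_format, OF t] n[OF t] \<rho>[OF t] \<gamma> sample_size[rule_format, OF t]
        by (rule deviation_prob_le)
      have law': "distr M (restrict_space borel (\<Xi> t)) (\<xi>hat t k) = \<nu> t"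
        if "t \<in> {2..T}" "k \<in> {1..n t}" for t k
        using law that by blast
      obtain A where A: "A \<in> sets M" "\<alpha> \<le> measure M A"
        and close: "\<And>\<omega> t. \<omega> \<in> A \<Longrightarrow> t \<in> {2..T} \<Longrightarrow>
          wasserstein (d t) (\<nu> t) (empirical (\<Xi> t) (n t) (\<lambda>k. \<xi>hat t k \<omega>)) \<le> ennreal (\<rho> t 0)"
        using prob_all_stages_close[OF M n indep law' dev[unfolded \<gamma>_def] \<alpha>] by blast
      show "\<exists>A \<in> sets M. measure M A \<ge> \<alpha> \<and>
              (\<forall>\<omega>\<in>A. stage_value T X f (P (\<lambda>t k. \<xi>hat t k \<omega>)) 1 x0 \<xi>1
                 \<le> eval_value T f \<nu> x0 \<xi>1 (y1 \<omega>) (pol \<omega>) + ennreal (2 * (\<Sum>t=2..T. l t * \<rho> t 0)))"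
      proof (intro bexI[of _ "A - N"] conjI ballI)
        show "A - N \<in> sets M"
          using A N by auto
        show "\<alpha> \<le> measure M (A - N)"
          using A N by (simp add: measure_Diff_null_set)
        fix \<omega> assume \<omega>: "\<omega> \<in> A - N"
        define s where "s = (\<lambda>t k. \<xi>hat t k \<omega>)"
        define R where "R = (\<Sum>t=2..T. l t * \<rho> t 0)"
        have \<omega>': "\<omega> \<in> space M - N"
          using \<omega> A(1) sets.sets_into_space by blast
        have lip: "lipschitz_in_uncertainty T X \<Xi> d l (stage_value T X f (P s))"
          and lip_nominal: "lipschitz_in_uncertainty T X \<Xi> d l (nominal_stage_value T X f n s)"
          and feasible: "strictly_feasible T \<Xi> n m g \<rho> s"
          and opt: "optimal_policy T X \<Xi> f (P s) x0 \<xi>1 (y1 \<omega>) (pol \<omega>)"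
          using good[OF \<omega>'] unfolding s_def by blast+
        have s: "s t k \<in> \<Xi> t" if "t \<in> {2..T}" "k \<in> {1..n t}" for t k
        proof -
          have "\<xi>hat t k \<in> M \<rightarrow>\<^sub>M restrict_space borel (\<Xi> t)"
            using indep that by (auto simp: indep_vars_def)
          from measurable_space[OF this, of \<omega>] show ?thesis
            using \<omega>' by (simp add: s_def space_restrict_space)
        qed
        have \<nu>': "\<nu> t \<in> wasserstein_space (\<Xi> t) (d t)" if "t \<in> {2..T}" for t
          using \<nu> that by blast
        have close': "wasserstein (d t) (\<nu> t) (empirical (\<Xi> t) (n t) (s t)) \<le> ennreal (\<rho> t 0)"
          if "t \<in> {2..T}" for t
          using close[of \<omega> t] \<omega> that by (simp add: s_def)
        have y1: "y1 \<omega> \<in> X 1"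
          using opt by (simp add: optimal_policy_def is_arg_min_def)
        have pol: "pol \<omega> t x \<xi> \<in> X t" if "t \<in> {2..T}" "x \<in> X (t - 1)" "\<xi> \<in> \<Xi> t" for t x \<xi>
          using opt that unfolding optimal_policy_def is_arg_min_def by blast
        have nominal: "nominal_stage_value T X f n s 1 x0 \<xi>1
            \<le> eval_value T f \<nu> x0 \<xi>1 (y1 \<omega>) (pol \<omega>) + ennreal R"
          unfolding R_def using n s \<rho> \<nu>' close' lip_nominal y1 pol
          by (rule nominal_value_le_eval_value(1))
        have R: "0 \<le> R"
          unfolding R_def using n s \<rho> \<nu>' close' lip_nominal y1 pol
          by (rule nominal_value_le_eval_value(2))
        have "stage_value T X f (P s) 1 x0 \<xi>1 \<le> nominal_stage_value T X f n s 1 x0 \<xi>1 + ennreal R"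
          unfolding R_def using s by (intro dr_le_nominal lip feasible) blast
        also have "\<dots> \<le> eval_value T f \<nu> x0 \<xi>1 (y1 \<omega>) (pol \<omega>) + ennreal R + ennreal R"
          by (rule add_right_mono) (rule nominal)
        also have "\<dots> = eval_value T f \<nu> x0 \<xi>1 (y1 \<omega>) (pol \<omega>) + ennreal (2 * R)"
          using R by (simp add: add.assoc flip: ennreal_plus)
        finally show "stage_value T X f (P (\<lambda>t k. \<xi>hat t k \<omega>)) 1 x0 \<xi>1
                 \<le> eval_value T f \<nu> x0 \<xi>1 (y1 \<omega>) (pol \<omega>) + ennreal (2 * (\<Sum>t=2..T. l t * \<rho> t 0))"
          unfolding s_def R_def .
      qed
    qed
  qed
qed

end
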